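(* Let $d\geq3$. For every $\varepsilon>0$, $q>2^*$ and $\alpha\in(0,2]$, there exists $C>0$, depending only on $d$, $q$ and $\alpha$, such that $$\|u\|_{L^q(\mathcal G_\varepsilon^d)}^q\leq C\,\varepsilon^{\frac q2+1-\alpha}\,\|u\|_{L^2(\mathcal G_\varepsilon^d)}^{\alpha}\,\|u'\|_{L^2(\mathcal G_\varepsilon^d)}^{q-\alpha}\qquad\forall u\in H^1(\mathcal G_\varepsilon^d).$$
   Context: $2^*=\frac{2d}{d-2}$ for $d\ge3$. For $\varepsilon>0$, $\mathcal G_\varepsilon^d\subset\mathbb R^d$ is the metric graph with vertex set $\varepsilon\mathbb Z^d$ and whose edges are the segments of length $\varepsilon$ joining pairs of vertices at distance $\varepsilon$. $L^q(\mathcal G_\varepsilon^d)$ norms are with respect to arclength on the edges, $u'$ is the derivative along edges, and $H^1(\mathcal G_\varepsilon^d)$ is the space of continuous functions $u$ on $\mathcal G_\varepsilon^d$ that are $H^1$ on each edge with $u,u'\in L^2(\mathcal G_\varepsilon^d)$. *)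

theory Defs
  imports "HOL-Analysis.Analysis"
begin

section \<open>The grid as a metric graph\<close>

definition grid_vertex :: "real \<Rightarrow> int ^ 'n \<Rightarrow> real ^ 'n" where
  "grid_vertex \<epsilon> k = (\<chi> j. \<epsilon> * of_int (k $ j))"

definition grid_vertices :: "real \<Rightarrow> (real ^ 'n) set" where
  "grid_vertices \<epsilon> = range (grid_vertex \<epsilon>)"

definition grid_edges :: "real \<Rightarrow> (real ^ 'n) set set" where
  "grid_edges \<epsilon> = {closed_segment x y | x y.
     x \<in> grid_vertices \<epsilon> \<and> y \<in> grid_vertices \<epsilon> \<and> dist x y = \<epsilon>}"

definition grid :: "real \<Rightarrow> (real ^ 'n) set" where
  "grid \<epsilon> = \<Union> (grid_edges \<epsilon>)"

text \<open>
  Edges are indexed by pairs \<open>(k, i)\<close>: the edge leaving the vertex \<open>\<epsilon>k\<close> in the positive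
  \<open>i\<close>-th coordinate direction, parametrised by arclength \<open>t \<in> [0, \<epsilon>]\<close>. By
  \<open>bij_betw_edge_path\<close> below every edge is counted exactly once. The choice of orientation only
  affects the sign of derivatives along the edge.
\<close>

type_synonym 'n edge = "(int ^ 'n) \<times> 'n"

definition edge_path :: "real \<Rightarrow> 'n::finite edge \<Rightarrow> real \<Rightarrow> real ^ 'n" where
  "edge_path \<epsilon> e t = grid_vertex \<epsilon> (fst e) + t *\<^sub>R axis (snd e) 1"

lemma edge_path_image:
  assumes "\<epsilon> > 0"
  shows "edge_path \<epsilon> (k, i) ` {0..\<epsilon>} =
    closed_segment (grid_vertex \<epsilon> k) (grid_vertex \<epsilon> (k + axis i 1))"
proof -
  have v: "grid_vertex \<epsilon> (k + axis i 1) = grid_vertex \<epsilon> k + \<epsilon> *\<^sub>R axis i 1"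
    by (simp add: vec_eq_iff grid_vertex_def axis_def algebra_simps)
  have "{0..\<epsilon>} = (\<lambda>s. s * \<epsilon>) ` {0..1}"
    using image_mult_atLeastAtMost[OF assms, of 0 1] by (simp add: mult.commute)
  then show ?thesis
    unfolding closed_segment_image_interval v
    by (simp add: image_image edge_path_def algebra_simps)
qed

lemma grid_vertex_inj: "\<epsilon> > 0 \<Longrightarrow> grid_vertex \<epsilon> k = grid_vertex \<epsilon> l \<longleftrightarrow> k = l"
  by (simp add: vec_eq_iff grid_vertex_def)

lemma int_unit_vector:
  fixes m :: "int ^ 'n"
  assumes "(\<Sum>j\<in>UNIV. (m $ j)\<^sup>2) = 1"
  shows "\<exists>i. m = axis i 1 \<or> m = - axis i 1"
proof -
  obtain i where i: "m $ i \<noteq> 0"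
    using assms by (metis (mono_tags, lifting) sum.neutral zero_neq_one zero_power2)
  have s: "(m $ i)\<^sup>2 + (\<Sum>j\<in>UNIV - {i}. (m $ j)\<^sup>2) = 1"
    using assms by (simp add: sum.remove)
  have "(m $ i)\<^sup>2 > 0" using i by simp
  moreover have "(\<Sum>j\<in>UNIV - {i}. (m $ j)\<^sup>2) \<ge> 0" by (simp add: sum_nonneg)
  ultimately have a: "(m $ i)\<^sup>2 = 1" and b: "(\<Sum>j\<in>UNIV - {i}. (m $ j)\<^sup>2) = 0"
    using s by linarith+
  have "m $ j = 0" if "j \<noteq> i" for j
    using b that by (simp add: sum_nonneg_eq_0_iff)
  then show ?thesis
    using a by (intro exI[of _ i]) (auto simp: vec_eq_iff axis_def power2_eq_1_iff)
qed

lemma dist_grid_vertex: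
  assumes "\<epsilon> > 0"
  shows "dist (grid_vertex \<epsilon> k) (grid_vertex \<epsilon> l) = \<epsilon> \<longleftrightarrow>
    (\<Sum>j\<in>UNIV. ((l - k) $ j)\<^sup>2) = 1"
proof -
  have "(\<Sum>j\<in>UNIV. (dist (grid_vertex \<epsilon> k $ j) (grid_vertex \<epsilon> l $ j))\<^sup>2)
      = (\<Sum>j\<in>UNIV. \<epsilon>\<^sup>2 * (of_int ((l - k) $ j))\<^sup>2)"
    by (intro sum.cong) (simp_all add: grid_vertex_def dist_real_def power2_eq_square algebra_simps)
  also have "\<dots> = \<epsilon>\<^sup>2 * of_int (\<Sum>j\<in>UNIV. ((l - k) $ j)\<^sup>2)"
    by (simp add: sum_distrib_left)
  finally have "dist (grid_vertex \<epsilon> k) (grid_vertex \<epsilon> l)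
      = \<epsilon> * sqrt (of_int (\<Sum>j\<in>UNIV. ((l - k) $ j)\<^sup>2))"
    using assms by (simp add: dist_vec_def L2_set_def real_sqrt_mult del: of_int_sum)
  then show ?thesis
    using assms by (simp del: of_int_sum)
qed

lemma sum_axis_square: "(\<Sum>j\<in>UNIV. (axis i (1::int) $ j)\<^sup>2) = 1"
proof -
  have "(axis i (1::int) $ j)\<^sup>2 = (if j = i then 1 else 0)" for j
    by (simp add: axis_def)
  then show ?thesis by simp
qed

lemma bij_betw_edge_path:
  assumes "\<epsilon> > 0"
  shows "bij_betw (\<lambda>e. edge_path \<epsilon> e ` {0..\<epsilon>}) (UNIV :: 'n::finite edge set) (grid_edges \<epsilon>)"
proof (rule bij_betwI')
  fix e f :: "'n edge"
  obtain k i l j where ef: "e = (k, i)" "f = (l, j)" by (cases e, cases f)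
  have "k = l \<and> i = j" if "closed_segment (grid_vertex \<epsilon> k) (grid_vertex \<epsilon> (k + axis i 1))
      = closed_segment (grid_vertex \<epsilon> l) (grid_vertex \<epsilon> (l + axis j 1))"
  proof -
    from that consider "k = l" "k + axis i 1 = l + axis j 1"
      | "k = l + axis j 1" "k + axis i 1 = l"
      by (auto simp: closed_segment_eq doubleton_eq_iff grid_vertex_inj[OF assms])
    then show ?thesis
    proof cases
      case 1
      then show ?thesis by (simp add: axis_eq_axis)
    next
      case 2
      then have "axis i (1::int) + axis j 1 = 0" by (simp add: algebra_simps)
      then have "(axis i (1::int) + axis j 1) $ i = 0" by simp
      then show ?thesis by (simp add: axis_def split: if_splits)
    qed
  qed
  then show "(edge_path \<epsilon> e ` {0..\<epsilon>} = edge_path \<epsilon> f ` {0..\<epsilon>}) = (e = f)"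
    unfolding ef edge_path_image[OF assms] by auto
next
  fix e :: "'n edge"
  obtain k i where e: "e = (k, i)" by (cases e)
  have "dist (grid_vertex \<epsilon> k) (grid_vertex \<epsilon> (k + axis i 1)) = \<epsilon>"
    by (simp add: dist_grid_vertex[OF assms] sum_axis_square)
  then show "edge_path \<epsilon> e ` {0..\<epsilon>} \<in> grid_edges \<epsilon>"
    unfolding e edge_path_image[OF assms] grid_edges_def grid_vertices_def by blast
next
  fix S :: "(real ^ 'n) set"
  assume "S \<in> grid_edges \<epsilon>"
  then obtain k l where S: "S = closed_segment (grid_vertex \<epsilon> k) (grid_vertex \<epsilon> l)"
    and d: "dist (grid_vertex \<epsilon> k) (grid_vertex \<epsilon> l) = \<epsilon>"
    unfolding grid_edges_def grid_vertices_def by blast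
  obtain i where "l - k = axis i 1 \<or> l - k = - axis i 1"
    using int_unit_vector d unfolding dist_grid_vertex[OF assms] by blast
  then consider "l = k + axis i 1" | "k = l + axis i 1"
    by (auto simp: algebra_simps)
  then show "\<exists>e\<in>UNIV. S = edge_path \<epsilon> e ` {0..\<epsilon>}"
  proof cases
    case 1
    then show ?thesis unfolding S using edge_path_image[OF assms, of k i] by auto
  next
    case 2
    then show ?thesis unfolding S using edge_path_image[OF assms, of l i]
      by (auto simp: closed_segment_commute)
  qed
qed


section \<open>Lebesgue and Sobolev spaces\<close>

definition Lp_interval :: "real \<Rightarrow> real \<Rightarrow> (real \<Rightarrow> real) set" where
  "Lp_interval \<epsilon> p = {f. f \<in> borel_measurable (lebesgue_on {0..\<epsilon>}) \<and>
     integrable (lebesgue_on {0..\<epsilon>}) (\<lambda>t. \<bar>f t\<bar> powr p)}"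

text \<open>
  The space \<open>C\<^sup>1\<^sub>c(0, \<epsilon>)\<close> of test functions (extended by zero to the real line).
\<close>

definition test_functions :: "real \<Rightarrow> (real \<Rightarrow> real) set" where
  "test_functions \<epsilon> = {\<phi>. (\<forall>t. \<phi> field_differentiable (at t)) \<and> continuous_on UNIV (deriv \<phi>) \<and>
     (\<exists>K. compact K \<and> K \<subseteq> {0<..<\<epsilon>} \<and> (\<forall>t. t \<notin> K \<longrightarrow> \<phi> t = 0))}"

definition weak_deriv_interval :: "real \<Rightarrow> (real \<Rightarrow> real) \<Rightarrow> (real \<Rightarrow> real) \<Rightarrow> bool" where
  "weak_deriv_interval \<epsilon> w g \<longleftrightarrow> (\<forall>\<phi> \<in> test_functions \<epsilon>.
     (LINT t|lebesgue_on {0..\<epsilon>}. w t * deriv \<phi> t) = - (LINT t|lebesgue_on {0..\<epsilon>}. g t * \<phi> t))"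

definition H1_interval :: "real \<Rightarrow> (real \<Rightarrow> real) set" where
  "H1_interval \<epsilon> =
     {w \<in> Lp_interval \<epsilon> 2. \<exists>g \<in> Lp_interval \<epsilon> 2. weak_deriv_interval \<epsilon> w g}"

text \<open>
  A function on the grid is represented by the family of its restrictions to the edges, in
  arclength coordinates. This also accommodates derivatives along edges, which have no common value
  at the vertices.
\<close>

definition on_edges :: "real \<Rightarrow> (real ^ 'n \<Rightarrow> real) \<Rightarrow> 'n::finite edge \<Rightarrow> real \<Rightarrow> real" where
  "on_edges \<epsilon> u e t = u (edge_path \<epsilon> e t)"

text \<open>
  The weak derivative on an edge is unique up to null sets, so the choice is immaterial for
  integrals.
\<close>

definition grid_deriv :: "real \<Rightarrow> (real ^ 'n \<Rightarrow> real) \<Rightarrow> 'n::finite edge \<Rightarrow> real \<Rightarrow> real" where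
  "grid_deriv \<epsilon> u e =
     (SOME g. g \<in> Lp_interval \<epsilon> 2 \<and> weak_deriv_interval \<epsilon> (on_edges \<epsilon> u e) g)"

definition Lp_grid :: "real \<Rightarrow> real \<Rightarrow> ('n::finite edge \<Rightarrow> real \<Rightarrow> real) set" where
  "Lp_grid \<epsilon> p = {f. (\<forall>e. f e \<in> Lp_interval \<epsilon> p) \<and>
     (\<lambda>e. LINT t|lebesgue_on {0..\<epsilon>}. \<bar>f e t\<bar> powr p) summable_on UNIV}"

definition Lp_grid_norm :: "real \<Rightarrow> real \<Rightarrow> ('n::finite edge \<Rightarrow> real \<Rightarrow> real) \<Rightarrow> real" where
  "Lp_grid_norm \<epsilon> p f =
     (\<Sum>\<^sub>\<infinity>e. LINT t|lebesgue_on {0..\<epsilon>}. \<bar>f e t\<bar> powr p) powr (1 / p)"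

definition H1_grid :: "real \<Rightarrow> (real ^ 'n::finite \<Rightarrow> real) set" where
  "H1_grid \<epsilon> = {u. continuous_on (grid \<epsilon>) u \<and> (\<forall>e. on_edges \<epsilon> u e \<in> H1_interval \<epsilon>) \<and>
     on_edges \<epsilon> u \<in> Lp_grid \<epsilon> 2 \<and> grid_deriv \<epsilon> u \<in> Lp_grid \<epsilon> 2}"

definition critical_exponent :: "nat \<Rightarrow> real" where
  "critical_exponent d = 2 * real d / (real d - 2)"

end

(*
  By the scaling in epsilon and interpolation it is enough to bound the q-th power of the L^q norm
  by epsilon^(q/2+1) |u'|_2^q (the case alpha = 0) and by epsilon^(q/2-1) |u|_2^2 |u'|_2^(q-2)
  (the case alpha = 2). Both follow from the discrete inequality |f|_q <= C |grad f|_2 on Z^d for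
  the vertex values f. To prove it, let f_r be the average of f over cubes of side r. Then
  |f_r| <= r^(-d/q) |f|_q pointwise and |f - f_r|_2 <= d r |grad f|_2. Where |f| is of size
  2 r^(-d/q) |f|_q, the average f_r carries at most half of f, so this region contributes at most
  a multiple of |f|_q^(q-2) r^(2 - d(q-2)/q) |grad f|_2^2 to the sum of |f|^q. For q > 2^* the
  exponent of r is negative and summing over dyadic r gives |f|_q^q <= C |f|_q^(q-2) |grad f|_2^2.
*)
theory Submission
  imports Defs
begin

section \<open>A Sobolev inequality on the integer lattice\<close>

text \<open>The last inequality of the discrete argument is divided by |f|_q^(q-2), so this norm
  must be known to be finite. That follows from square summability of the vertex values, whose size
  does not enter the constant. The averaging scale varies with the point: it is dictated by |f x|,
  and large values are compared with small cubes. The lattice has no scales below 1 and |f x| <=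
  |f|_q, which is why arbitrarily large q are covered; at q = 2^* all scales would contribute
  equally and the series would diverge. The weak derivative enters only through the oscillation of u
  along an edge, which is at most sqrt \<epsilon> times the L^2 norm of u' there. This is read off
  from explicit C^1 test functions. With M = \<epsilon> |u'|_2^2, which bounds each squared edge
  oscillation and the squared l^2 norm of the vertex differences in each coordinate direction, the
  two endpoint bounds become \<epsilon> M^(q/2) and M^(q/2-1) |u|_2^2, with constants free of
  \<epsilon>.\<close>

lemma convex_on_powr_nonneg:
  assumes "p \<ge> 1"
  shows "convex_on {0..} (\<lambda>x::real. x powr p)"
proof (rule convex_onI)
  fix t x y :: real
  assume t: "0 < t" "t < 1" and "x \<in> {0..}" "y \<in> {0..}"
  then have xy: "0 \<le> x" "0 \<le> y" by auto
  \<comment> \<open>Covers the endpoint 0, where convexity reduces to s^p <= s for s in [0, 1]. It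
    must be included because |f| may vanish inside a cube.\<close>
  have scale: "(s * z) powr p \<le> s * z powr p" if "0 \<le> s" "s \<le> 1" "0 \<le> z" for s z :: real
  proof -
    have "s powr p \<le> s powr 1"
      using that assms by (intro powr_mono') auto
    then show ?thesis
      using that by (simp add: powr_mult mult_right_mono)
  qed
  show "((1 - t) *\<^sub>R x + t *\<^sub>R y) powr p \<le> (1 - t) * x powr p + t * y powr p"
  proof (cases "x = 0 \<or> y = 0")
    case True
    then show ?thesis
      using scale[of t y] scale[of "1 - t" x] t xy by auto
  next
    case False
    then show ?thesis
      using convex_onD[OF powr_convex[OF assms], of t x y] t xy by auto
  qed
qed (rule convex_real_interval)

section \<open>Translation differences in l^2\<close>

text \<open>Uniform bounds on finite sums stand in for the l^2 norm of the difference: no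
  summability has to be carried along, whereas a divergent infinite sum would have the value
  0.\<close>

definition shift_bound :: "('a::ab_group_add \<Rightarrow> real) \<Rightarrow> 'a \<Rightarrow> real \<Rightarrow> bool" where
  "shift_bound f v b \<longleftrightarrow> (\<forall>A. finite A \<longrightarrow> L2_set (\<lambda>x. f (x + v) - f x) A \<le> b)"

lemma shift_bound_0: "shift_bound f 0 0"
  by (simp add: shift_bound_def L2_set_def)

text \<open>Triangle inequality along x, x + v, x + v + w. The second difference over
  \<open>A\<close> is the \<open>w\<close>-difference over the translate of \<open>A\<close> by
  \<open>v\<close>, again a finite set.\<close>

lemma shift_bound_add:
  assumes "shift_bound f v b" and "shift_bound f w c"
  shows "shift_bound f (v + w) (b + c)"
  unfolding shift_bound_def
proof (intro allI impI)
  fix A :: "'a set"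
  assume A: "finite A"
  have "L2_set (\<lambda>x. f (x + (v + w)) - f x) A
      = L2_set (\<lambda>x. (f (x + v) - f x) + (f (x + v + w) - f (x + v))) A"
    by (simp add: algebra_simps)
  also have "\<dots> \<le> L2_set (\<lambda>x. f (x + v) - f x) A + L2_set (\<lambda>x. f (x + v + w) - f (x + v)) A"
    by (rule L2_set_triangle_ineq)
  also have "L2_set (\<lambda>x. f (x + v + w) - f (x + v)) A
      = L2_set (\<lambda>x. f (x + w) - f x) ((\<lambda>x. x + v) ` A)"
    unfolding L2_set_def by (subst sum.reindex) (auto simp: inj_on_def)
  also have "L2_set (\<lambda>x. f (x + v) - f x) A + \<dots> \<le> b + c"
    using assms A unfolding shift_bound_def by (intro add_mono) auto
  finally show "L2_set (\<lambda>x. f (x + (v + w)) - f x) A \<le> b + c" by simp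
qed

lemma shift_bound_mono: "shift_bound f v b \<Longrightarrow> b \<le> c \<Longrightarrow> shift_bound f v c"
  unfolding shift_bound_def by (meson order_trans)

lemma shift_bound_nonneg: "shift_bound f v b \<Longrightarrow> 0 \<le> b"
  unfolding shift_bound_def by (force simp: L2_set_def dest: spec[of _ "{}"])

lemma shift_bound_sum:
  assumes "finite I" and "\<And>i. i \<in> I \<Longrightarrow> shift_bound f (v i) b"
  shows "shift_bound f (\<Sum>i\<in>I. v i) (real (card I) * b)"
  using assms
proof (induction I rule: finite_induct)
  case (insert i I)
  have "shift_bound f (v i + (\<Sum>i\<in>I. v i)) (b + real (card I) * b)"
    using insert by (intro shift_bound_add) auto
  then show ?case
    using insert by (simp add: algebra_simps)
qed (simp add: shift_bound_0)

text \<open>A path from 0 to \<open>v\<close> makes fewer than \<open>r\<close> unit steps in each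
  of the CARD('n) directions, each costing \<open>b\<close>. This is the origin of the factor d r in
  the deviation of f from its average.\<close>

lemma shift_bound_box:
  fixes f :: "int ^ 'n::finite \<Rightarrow> real"
  assumes "\<And>i. shift_bound f (axis i 1) b"
    and v: "\<And>i. 0 \<le> v $ i \<and> v $ i < int r"
  shows "shift_bound f v (real CARD('n) * (real r * b))"
proof -
  have b: "0 \<le> b"
    using assms(1) shift_bound_nonneg by blast
  have ax: "shift_bound f (axis i (int m)) (real m * b)" for i m
  proof (induction m)
    case 0
    have "axis i 0 = (0 :: int ^ 'n)" by (simp add: vec_eq_iff axis_def)
    then show ?case
      using shift_bound_0[of f] by (metis mult_zero_left of_nat_0)
  next
    case (Suc m)
    have "axis i (int (Suc m)) = axis i (int m) + (axis i 1 :: int ^ 'n)"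
      by (simp add: vec_eq_iff axis_def)
    then show ?case
      using shift_bound_add[OF Suc assms(1)[of i]] by (simp add: algebra_simps)
  qed
  have "shift_bound f (axis i (v $ i)) (real r * b)" for i
  proof (rule shift_bound_mono)
    show "shift_bound f (axis i (v $ i)) (real (nat (v $ i)) * b)"
      using ax[of i "nat (v $ i)"] v[of i] by simp
    show "real (nat (v $ i)) * b \<le> real r * b"
      using v[of i] b by (intro mult_right_mono) auto
  qed
  then have "shift_bound f (\<Sum>i\<in>UNIV. axis i (v $ i)) (real CARD('n) * (real r * b))"
    by (intro shift_bound_sum) auto
  also have "(\<Sum>i\<in>UNIV. axis i (v $ i)) = v"
    by (simp add: vec_eq_iff axis_def)
  finally show ?thesis .
qed

section \<open>Averages over cubes: size and deviation\<close>

definition lattice_box :: "nat \<Rightarrow> (int ^ 'n) set" where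
  "lattice_box r = {v. \<forall>i. 0 \<le> v $ i \<and> v $ i < int r}"

lemma bij_betw_lattice_box: "bij_betw vec_lambda (PiE UNIV (\<lambda>_. {0..<int r})) (lattice_box r)"
  by (rule bij_betwI[where g = vec_nth]) (auto simp: lattice_box_def)

lemma finite_lattice_box: "finite (lattice_box r :: (int ^ 'n::finite) set)"
  by (rule iffD1[OF bij_betw_finite[OF bij_betw_lattice_box]]) (simp add: finite_PiE)

lemma card_lattice_box: "card (lattice_box r :: (int ^ 'n::finite) set) = r ^ CARD('n)"
  using bij_betw_same_card[OF bij_betw_lattice_box[of r, where 'a = 'n]]
  by (simp add: card_PiE)

text \<open>The cube has \<open>x\<close> as a corner, not as its centre, so that only shifts with
  nonnegative coordinates occur and the steps \<open>axis i 1\<close> suffice.\<close>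

definition box_avg :: "nat \<Rightarrow> (int ^ 'n::finite \<Rightarrow> real) \<Rightarrow> int ^ 'n \<Rightarrow> real" where
  "box_avg r f x = (\<Sum>v\<in>lattice_box r. f (x + v)) / real r ^ CARD('n)"

text \<open>Jensen's inequality for the q-th power: the q-th power of the average is at most the
  mean of |f|^q over r^d points, hence at most N^q / r^d.\<close>

lemma abs_box_avg_le:
  fixes f :: "int ^ 'n::finite \<Rightarrow> real"
  assumes "q \<ge> 1" "r > 0"
    and bd: "\<And>A. finite A \<Longrightarrow> (\<Sum>x\<in>A. \<bar>f x\<bar> powr q) \<le> N powr q" and "N \<ge> 0"
  shows "\<bar>box_avg r f x\<bar> \<le> N * real r powr (- (CARD('n) / q))"
proof -
  let ?B = "lattice_box r :: (int ^ 'n) set" and ?m = "real r ^ CARD('n)"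
  have m: "?m > 0" using assms by simp
  have card: "real (card ?B) = ?m" by (simp add: card_lattice_box)
  then have ne: "?B \<noteq> {}" using m by auto
  have "\<bar>box_avg r f x\<bar> \<le> (\<Sum>v\<in>?B. (1 / ?m) *\<^sub>R \<bar>f (x + v)\<bar>)"
    unfolding box_avg_def using m
    by (simp add: sum_distrib_left[symmetric] sum_divide_distrib[symmetric] divide_right_mono)
  then have "\<bar>box_avg r f x\<bar> powr q \<le> (\<Sum>v\<in>?B. (1 / ?m) *\<^sub>R \<bar>f (x + v)\<bar>) powr q"
    using assms by (intro powr_mono2) auto
  also have "\<dots> \<le> (\<Sum>v\<in>?B. 1 / ?m * \<bar>f (x + v)\<bar> powr q)"
    using m ne by (intro convex_on_sum[OF finite_lattice_box _ convex_on_powr_nonneg[OF assms(1)]])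
      (auto simp: card_lattice_box)
  also have "\<dots> = 1 / ?m * (\<Sum>y\<in>(\<lambda>v. x + v) ` ?B. \<bar>f y\<bar> powr q)"
    by (subst sum.reindex) (auto simp: sum_distrib_left)
  also have "\<dots> \<le> 1 / ?m * N powr q"
    using m by (intro mult_left_mono bd finite_imageI finite_lattice_box) auto
  also have "\<dots> = (N * real r powr (- (CARD('n) / q))) powr q"
  proof -
    have "(N * real r powr (- (CARD('n) / q))) powr q = N powr q * real r powr (- real CARD('n))"
      using assms by (simp add: powr_mult powr_powr del: powr_minus_divide)
    then show ?thesis
      using assms by (simp add: powr_minus powr_realpow field_simps)
  qed
  finally have le: "\<bar>box_avg r f x\<bar> powr q \<le> (N * real r powr (- (CARD('n) / q))) powr q" .
  show ?thesis
  proof (rule ccontr)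
    assume "\<not> ?thesis"
    then have "(N * real r powr (- (CARD('n) / q))) powr q < \<bar>box_avg r f x\<bar> powr q"
      using assms by (intro powr_less_mono2) auto
    with le show False by simp
  qed
qed

text \<open>The deviation is the mean of f x - f (x + v) over the cube. Cauchy-Schwarz moves the
  square inside the mean; after exchanging the sums, each fixed \<open>v\<close> is handled by
  \<open>shift_bound_box\<close>.\<close>

lemma sum_deviation_box_avg_le:
  fixes f :: "int ^ 'n::finite \<Rightarrow> real"
  assumes b: "\<And>i. shift_bound f (axis i 1) b" and "r > 0" and A: "finite A"
  shows "(\<Sum>x\<in>A. (f x - box_avg r f x)\<^sup>2) \<le> (real CARD('n) * (real r * b))\<^sup>2"
proof -
  let ?B = "lattice_box r :: (int ^ 'n) set" and ?m = "real r ^ CARD('n)"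
  have m: "?m > 0" using assms by simp
  have card: "real (card ?B) = ?m" by (simp add: card_lattice_box)
  have b0: "b \<ge> 0" using b shift_bound_nonneg by blast
  have dev: "(f x - box_avg r f x)\<^sup>2 \<le> (\<Sum>v\<in>?B. (f (x + v) - f x)\<^sup>2) / ?m" for x
  proof -
    have "box_avg r f x - f x = (\<Sum>v\<in>?B. f (x + v) - f x) / ?m"
      using m by (simp add: box_avg_def sum_subtractf card diff_divide_distrib)
    then have "(f x - box_avg r f x)\<^sup>2 = (\<Sum>v\<in>?B. f (x + v) - f x)\<^sup>2 / ?m\<^sup>2"
      by (metis power2_commute power_divide)
    also have "\<dots> \<le> ((\<Sum>v\<in>?B. (f (x + v) - f x)\<^sup>2) * ?m) / ?m\<^sup>2"
      using sum_squared_le_sum_of_squares[of "\<lambda>v. f (x + v) - f x" ?B] m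
      by (intro divide_right_mono) (auto simp: card)
    finally show ?thesis
      using m by (simp add: power2_eq_square)
  qed
  have shift: "(\<Sum>x\<in>A. (f (x + v) - f x)\<^sup>2) \<le> (real CARD('n) * (real r * b))\<^sup>2" if "v \<in> ?B" for v
  proof -
    have "shift_bound f v (real CARD('n) * (real r * b))"
      using that by (intro shift_bound_box b) (auto simp: lattice_box_def)
    then have "sqrt (\<Sum>x\<in>A. (f (x + v) - f x)\<^sup>2) \<le> real CARD('n) * (real r * b)"
      using A by (simp add: shift_bound_def L2_set_def)
    then show ?thesis
      by (rule sqrt_le_D)
  qed
  have "(\<Sum>x\<in>A. (f x - box_avg r f x)\<^sup>2) \<le> (\<Sum>x\<in>A. (\<Sum>v\<in>?B. (f (x + v) - f x)\<^sup>2) / ?m)"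
    by (intro sum_mono dev)
  also have "\<dots> = (\<Sum>v\<in>?B. \<Sum>x\<in>A. (f (x + v) - f x)\<^sup>2) / ?m"
    by (subst sum.swap) (simp add: sum_divide_distrib)
  also have "\<dots> \<le> (\<Sum>v\<in>?B. (real CARD('n) * (real r * b))\<^sup>2) / ?m"
    using m by (intro divide_right_mono sum_mono shift) auto
  also have "\<dots> = (real CARD('n) * (real r * b))\<^sup>2"
    using m by (simp add: card)
  finally show ?thesis .
qed

section \<open>Dyadic scales and the discrete Sobolev inequality\<close>

text \<open>After clearing denominators, q > 2^* reads q (d - 2) > 2 d. In its second form it says
  that the power of the scale r in the dyadic sum is negative.\<close>

lemma critical_exponent_gtD:
  assumes "d \<ge> 3" and "q > critical_exponent d"
  shows "q > 2" and "real d / q * (q - 2) - 2 > 0"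
proof -
  have d: "real d \<ge> 3" using assms by simp
  have h: "2 * real d < q * (real d - 2)"
    using assms d by (simp add: critical_exponent_def field_simps)
  show q: "q > 2"
  proof (rule ccontr)
    assume "\<not> q > 2"
    then have "q * (real d - 2) \<le> 2 * (real d - 2)" using d by (intro mult_right_mono) auto
    with h d show False by simp
  qed
  have "real d / q * (q - 2) - 2 = (q * (real d - 2) - 2 * real d) / q"
    using q by (simp add: field_simps)
  then show "real d / q * (q - 2) - 2 > 0"
    using h q by simp
qed

text \<open>
  The averaging scale \<open>2 ^ j\<close> is chosen at each point as the smallest one for which the average
  is at most half of the value; the contributions of the scales then form a geometric series.
\<close>

lemma sum_powr_le_dyadic:
  fixes f :: "int ^ 'n::finite \<Rightarrow> real" and q :: real
  defines "\<theta> \<equiv> CARD('n) / q"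
  defines "\<beta> \<equiv> \<theta> * (q - 2) - 2"
  assumes q: "q > 2" and \<beta>: "\<beta> > 0"
    and b: "\<And>i. shift_bound f (axis i 1) b"
    and bd: "\<And>A. finite A \<Longrightarrow> (\<Sum>x\<in>A. \<bar>f x\<bar> powr q) \<le> N powr q" and N: "N > 0"
    and A: "finite A"
  shows "(\<Sum>x\<in>A. \<bar>f x\<bar> powr q) \<le>
    (2 * 2 powr \<theta>) powr (q - 2) * 4 * (real CARD('n))\<^sup>2 / (1 - 2 powr - \<beta>) * N powr (q - 2) * b\<^sup>2"
proof -
  define A' where "A' = {x \<in> A. f x \<noteq> 0}"
  have A': "finite A'" using A by (simp add: A'_def)
  \<comment> \<open>The scale 2^j is admissible at \<open>x\<close> if the a priori bound N
    2^(-\<theta> j) on the average is at most half of |f x|.\<close>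
  define P where "P x j \<longleftrightarrow> 2 * N * 2 powr (- \<theta> * real j) \<le> \<bar>f x\<bar>" for x j
  define J where "J x = (LEAST j. P x j)" for x
  \<comment> \<open>The factor \<open>2 powr \<theta>\<close> pays for going back one scale: by
    minimality the scale before \<open>J x\<close> is not admissible, which bounds |f x| from
    above.\<close>
  define K where "K = 2 * 2 powr \<theta> * N"
  have \<theta>: "\<theta> > 0" using q by (simp add: \<theta>_def)
  have \<theta>1: "2 powr (- \<theta>) < 1"
    using powr_less_mono[of "- \<theta>" 0 2] \<theta> by simp
  \<comment> \<open>An admissible scale exists because the bound on the average tends to 0 while |f
    x| is positive; otherwise \<open>LEAST\<close> would say nothing.\<close>
  have P: "P x (J x)" if "f x \<noteq> 0" for x
  proof -
    have "(\<lambda>j. 2 * N * (2 powr (- \<theta>)) ^ j) \<longlonglongrightarrow> 2 * N * 0"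
      using \<theta>1 by (intro tendsto_mult tendsto_const LIMSEQ_realpow_zero) auto
    then have "eventually (\<lambda>j. 2 * N * (2 powr (- \<theta>)) ^ j < \<bar>f x\<bar>) sequentially"
      using that by (intro order_tendstoD) auto
    then obtain j where "2 * N * (2 powr (- \<theta>)) ^ j < \<bar>f x\<bar>"
      by (auto simp: eventually_sequentially)
    then have "P x j"
      by (simp add: P_def powr_power mult.commute)
    then show ?thesis
      unfolding J_def by (rule LeastI)
  qed
  have fN: "\<bar>f x\<bar> \<le> N" for x
  proof (rule ccontr)
    assume "\<not> \<bar>f x\<bar> \<le> N"
    then have "N powr q < \<bar>f x\<bar> powr q" using q N by (intro powr_less_mono2) auto
    with bd[of "{x}"] show False by simp
  qed
  have up: "\<bar>f x\<bar> \<le> K * 2 powr (- \<theta> * real (J x))" if "f x \<noteq> 0" for x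
  proof (cases "J x")
    case 0
    have "N * 1 \<le> N * (2 * 2 powr \<theta>)"
      using N \<theta> ge_one_powr_ge_zero[of 2 \<theta>] by (intro mult_left_mono) auto
    then show ?thesis
      using fN[of x] 0 by (simp add: K_def mult_ac)
  next
    case (Suc j)
    then have "\<not> P x j"
      unfolding J_def using not_less_Least[of j "P x"] by simp
    moreover have "2 powr \<theta> * 2 powr (- \<theta> * real (Suc j)) = 2 powr (- \<theta> * real j)"
      by (simp add: powr_add[symmetric] algebra_simps)
    ultimately show ?thesis
      using Suc by (simp add: P_def K_def mult_ac)
  qed
  \<comment> \<open>Since the average is at most |f x| / 2, the deviation carries the other half;
    squaring gives the factor 4.\<close>
  have dev: "(f x)\<^sup>2 \<le> 4 * (f x - box_avg (2 ^ J x) f x)\<^sup>2" if "f x \<noteq> 0" for x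
  proof -
    have "\<bar>box_avg (2 ^ J x) f x\<bar> \<le> N * real (2 ^ J x) powr (- \<theta>)"
      unfolding \<theta>_def using q N by (intro abs_box_avg_le bd) auto
    also have "real (2 ^ J x) powr (- \<theta>) = 2 powr (- \<theta> * real (J x))"
      by (simp add: powr_realpow[symmetric] powr_powr mult.commute)
    also have "N * \<dots> \<le> \<bar>f x\<bar> / 2"
      using P[OF that] by (simp add: P_def)
    finally have "\<bar>f x\<bar> \<le> 2 * \<bar>f x - box_avg (2 ^ J x) f x\<bar>"
      using abs_triangle_ineq[of "f x - box_avg (2 ^ J x) f x" "box_avg (2 ^ J x) f x"] by simp
    then have "\<bar>f x\<bar>\<^sup>2 \<le> (2 * \<bar>f x - box_avg (2 ^ J x) f x\<bar>)\<^sup>2"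
      by (intro power_mono) auto
    then show ?thesis by (simp add: power_mult_distrib)
  qed
  define D where "D = 4 * (real CARD('n))\<^sup>2 * K powr (q - 2) * b\<^sup>2"
  have K: "K > 0" using N by (simp add: K_def)
  have D: "D \<ge> 0" by (simp add: D_def)
  \<comment> \<open>Of the q factors |f x|, q - 2 are bounded by \<open>up\<close> and two by
    \<open>dev\<close>. The l^2 deviation contributes 4^j, against 2^(-\<theta> j (q - 2)) from
    \<open>up\<close>; the product is 2^(-\<beta> j).\<close>
  have level: "(\<Sum>x\<in>{x \<in> A'. J x = j}. \<bar>f x\<bar> powr q) \<le> D * (2 powr - \<beta>) ^ j" for j
  proof -
    let ?S = "{x \<in> A'. J x = j}" and ?c = "(K * 2 powr (- \<theta> * real j)) powr (q - 2)"
    have "(\<Sum>x\<in>?S. \<bar>f x\<bar> powr q) \<le> (\<Sum>x\<in>?S. ?c * (4 * (f x - box_avg (2 ^ j) f x)\<^sup>2))"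
    proof (rule sum_mono)
      fix x assume "x \<in> ?S"
      then have x: "f x \<noteq> 0" "J x = j" by (auto simp: A'_def)
      have "\<bar>f x\<bar> powr q = \<bar>f x\<bar> powr (q - 2) * (f x)\<^sup>2"
        using x powr_add[of "\<bar>f x\<bar>" "q - 2" 2] by simp
      also have "\<dots> \<le> ?c * (4 * (f x - box_avg (2 ^ j) f x)\<^sup>2)"
        using up[OF x(1)] dev[OF x(1)] x q by (intro mult_mono powr_mono2) auto
      finally show "\<bar>f x\<bar> powr q \<le> ?c * (4 * (f x - box_avg (2 ^ j) f x)\<^sup>2)" .
    qed
    also have "\<dots> = ?c * 4 * (\<Sum>x\<in>?S. (f x - box_avg (2 ^ j) f x)\<^sup>2)"
      by (simp add: sum_distrib_left mult_ac)
    also have "\<dots> \<le> ?c * 4 * (real CARD('n) * (real (2 ^ j) * b))\<^sup>2"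
      using A' by (intro mult_left_mono sum_deviation_box_avg_le b) auto
    also have "\<dots> = D * (2 powr (- \<theta> * real j * (q - 2)) * (2 ^ j)\<^sup>2)"
      using K by (simp add: D_def powr_mult powr_powr power_mult_distrib)
    also have "(2 ^ j)\<^sup>2 = 2 powr (2 * real j)"
      using powr_realpow[of 2 "2 * j"] by (simp add: power_mult[symmetric] mult.commute)
    also have "2 powr (- \<theta> * real j * (q - 2)) * 2 powr (2 * real j) = (2 powr - \<beta>) ^ j"
      by (simp add: powr_add[symmetric] powr_power \<beta>_def algebra_simps)
    finally show ?thesis .
  qed
  have c: "2 powr - \<beta> < 1" "0 < 2 powr - \<beta>"
    using powr_less_mono[of "- \<beta>" 0 2] \<beta> by auto
  have "(\<Sum>x\<in>A. \<bar>f x\<bar> powr q) = (\<Sum>x\<in>A'. \<bar>f x\<bar> powr q)"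
    using A by (intro sum.mono_neutral_right) (auto simp: A'_def)
  also have "\<dots> = (\<Sum>j\<in>J ` A'. \<Sum>x\<in>{x \<in> A'. J x = j}. \<bar>f x\<bar> powr q)"
    using A' by (intro sum.group[symmetric]) auto
  also have "\<dots> \<le> (\<Sum>j\<in>J ` A'. D * (2 powr - \<beta>) ^ j)"
    by (intro sum_mono level)
  also have "\<dots> = D * (\<Sum>j\<in>J ` A'. (2 powr - \<beta>) ^ j)"
    by (simp add: sum_distrib_left)
  \<comment> \<open>Only finitely many levels occur, but their number depends on \<open>A\<close>;
    the full geometric series bounds them uniformly.\<close>
  also have "(\<Sum>j\<in>J ` A'. (2 powr - \<beta>) ^ j) \<le> (\<Sum>j. (2 powr - \<beta>) ^ j)"
    using A' c by (intro sum_le_suminf summable_geometric) auto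
  also have "(\<Sum>j. (2 powr - \<beta>) ^ j) = 1 / (1 - 2 powr - \<beta>)"
    using c by (intro suminf_geometric) auto
  finally have "(\<Sum>x\<in>A. \<bar>f x\<bar> powr q) \<le> D * (1 / (1 - 2 powr - \<beta>))"
    using D by (simp add: mult_left_mono)
  also have "\<dots> = (2 * 2 powr \<theta>) powr (q - 2) * 4 * (real CARD('n))\<^sup>2 / (1 - 2 powr - \<beta>)
      * N powr (q - 2) * b\<^sup>2"
    using N by (simp add: D_def K_def powr_mult)
  finally show ?thesis .
qed

lemma power2_powr_half: "z \<ge> 0 \<Longrightarrow> (z\<^sup>2) powr (p / 2) = z powr p" for z p :: real
  using powr_powr[of z 2 "p / 2"] by (cases "z = 0") auto

text \<open>With N = |f|_q the dyadic estimate reads N^q <= K N^(q-2) b^2. Summability makes N a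
  genuine finite norm, so N^(q-2) cancels; raising N^2 <= K b^2 to the power q/2 gives the constant
  \<open>K powr (q / 2)\<close>.\<close>

lemma discrete_Sobolev:
  fixes q :: real
  assumes "CARD('n::finite) \<ge> 3" and "q > critical_exponent CARD('n)"
  obtains C where "C > 0" and
    "\<And>(f :: int ^ 'n \<Rightarrow> real) b. (\<lambda>x. \<bar>f x\<bar> powr q) summable_on UNIV \<Longrightarrow>
      (\<And>i. shift_bound f (axis i 1) b) \<Longrightarrow> (\<Sum>\<^sub>\<infinity>x. \<bar>f x\<bar> powr q) \<le> C * b powr q"
proof -
  define \<theta> where "\<theta> = CARD('n) / q"
  define \<beta> where "\<beta> = \<theta> * (q - 2) - 2"
  define K where "K = (2 * 2 powr \<theta>) powr (q - 2) * 4 * (real CARD('n))\<^sup>2 / (1 - 2 powr - \<beta>)"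
  have q: "q > 2" and \<beta>: "\<beta> > 0"
    using critical_exponent_gtD[OF assms] by (auto simp: \<beta>_def \<theta>_def)
  have "2 powr - \<beta> < 1"
    using powr_less_mono[of "- \<beta>" 0 2] \<beta> by auto
  then have K: "K > 0" by (simp add: K_def)
  show thesis
  proof (rule that)
    show "K powr (q / 2) > 0" using K by simp
    fix f :: "int ^ 'n \<Rightarrow> real" and b
    assume summ: "(\<lambda>x. \<bar>f x\<bar> powr q) summable_on UNIV" and b: "\<And>i. shift_bound f (axis i 1) b"
    let ?S = "\<Sum>\<^sub>\<infinity>x. \<bar>f x\<bar> powr q"
    have b0: "b \<ge> 0" using b shift_bound_nonneg by blast
    have S0: "?S \<ge> 0" by (intro infsum_nonneg) auto
    show "?S \<le> K powr (q / 2) * b powr q"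
    proof (cases "?S = 0")
      case False
      define N where "N = ?S powr (1 / q)"
      have N: "N > 0" using False by (simp add: N_def)
      have Nq: "N powr q = ?S" using q S0 by (simp add: N_def powr_powr)
      have fin: "(\<Sum>x\<in>A. \<bar>f x\<bar> powr q) \<le> N powr q" if "finite A" for A
        unfolding Nq using that summ by (intro finite_sum_le_infsum) auto
      have "?S \<le> K * N powr (q - 2) * b\<^sup>2"
      proof (rule infsum_le_finite_sums[OF summ])
        fix A :: "(int ^ 'n) set"
        assume "finite A"
        then show "(\<Sum>x\<in>A. \<bar>f x\<bar> powr q) \<le> K * N powr (q - 2) * b\<^sup>2"
          unfolding K_def \<beta>_def \<theta>_def
          using sum_powr_le_dyadic[of q f b N A] q \<beta> b fin N by (simp add: \<beta>_def \<theta>_def)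
      qed
      then have "N powr (q - 2) * N\<^sup>2 \<le> N powr (q - 2) * (K * b\<^sup>2)"
        using N powr_add[of N "q - 2" 2] by (simp add: Nq[symmetric] mult_ac)
      then have "N\<^sup>2 \<le> K * b\<^sup>2"
        using N by (simp add: mult_le_cancel_left_pos)
      then have "(N\<^sup>2) powr (q / 2) \<le> (K * b\<^sup>2) powr (q / 2)"
        using q by (intro powr_mono2) auto
      then show ?thesis
        using N b0 K by (simp add: powr_mult Nq power2_powr_half)
    qed simp
  qed
qed

section \<open>Oscillation of a weakly differentiable function on an interval\<close>

definition ramp :: "real \<Rightarrow> real" where
  "ramp x = max 0 x"

text \<open>The hat function supported on [0, 2] with peak 1 at 1, hence of mass 1, written as a
  second difference of \<open>ramp\<close>.\<close>

definition tent :: "real \<Rightarrow> real" where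
  "tent x = ramp x - 2 * ramp (x - 1) + ramp (x - 2)"

text \<open>The antiderivative of \<open>tent\<close>: a quadratic spline rising from 0 to 1 on
  [0, 2]. It is exactly as regular as \<open>test_functions\<close> demands, so no mollifier has to
  be constructed.\<close>

definition smooth_step :: "real \<Rightarrow> real" where
  "smooth_step x = ((ramp x)\<^sup>2 - 2 * (ramp (x - 1))\<^sup>2 + (ramp (x - 2))\<^sup>2) / 2"

lemma has_real_derivative_ramp_square:
  assumes "(f has_real_derivative D) (at x)"
  shows "((\<lambda>x. (ramp (f x))\<^sup>2) has_real_derivative 2 * ramp (f x) * D) (at x)"
proof -
  have "((\<lambda>x. (ramp x)\<^sup>2) has_real_derivative 2 * ramp y) (at y)" for y
    unfolding has_field_derivative_iff LIM_def
  proof (intro allI impI)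
    fix e :: real assume e: "0 < e"
    have "dist (((ramp z)\<^sup>2 - (ramp y)\<^sup>2) / (z - y)) (2 * ramp y) < e"
      if z: "z \<noteq> y" "dist z y < e" for z
    proof -
      have sq: "(z - y)\<^sup>2 = z * z - 2 * (y * z) + y * y"
        by (simp add: power2_eq_square algebra_simps)
      \<comment> \<open>The remainder is quadratic for every position of y and z relative to the
        kink at 0. Hence the difference quotient is off by at most |z - y|, and the radius can be
        \<open>e\<close> itself.\<close>
      have "\<bar>(ramp z)\<^sup>2 - (ramp y)\<^sup>2 - 2 * ramp y * (z - y)\<bar> \<le> (z - y)\<^sup>2"
      proof (cases "y \<ge> 0")
        case True
        show ?thesis
        proof (cases "z \<ge> 0")
          case z: True
          then have "(ramp z)\<^sup>2 - (ramp y)\<^sup>2 - 2 * ramp y * (z - y) = (z - y)\<^sup>2"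
            using True by (simp add: ramp_def power2_eq_square algebra_simps)
          then show ?thesis by simp
        next
          case z: False
          then have "(ramp z)\<^sup>2 - (ramp y)\<^sup>2 - 2 * ramp y * (z - y) = y * y - 2 * (y * z)"
            using True by (simp add: ramp_def power2_eq_square algebra_simps)
          then show ?thesis
            using True z mult_nonneg_nonpos[of y z] zero_le_square[of y] zero_le_square[of z]
            unfolding sq by linarith
        qed
      next
        case False
        then have "(ramp z)\<^sup>2 - (ramp y)\<^sup>2 - 2 * ramp y * (z - y) = (if z \<ge> 0 then z * z else 0)"
          by (simp add: ramp_def power2_eq_square)
        moreover have "z * z \<le> (z - y)\<^sup>2" if "z \<ge> 0"
          using that False mult_nonpos_nonneg[of y z] zero_le_square[of y]
          unfolding sq by linarith
        ultimately show ?thesis by simp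
      qed
      moreover have "((ramp z)\<^sup>2 - (ramp y)\<^sup>2) / (z - y) - 2 * ramp y
          = ((ramp z)\<^sup>2 - (ramp y)\<^sup>2 - 2 * ramp y * (z - y)) / (z - y)"
        using z by (simp add: diff_divide_distrib)
      ultimately have "\<bar>((ramp z)\<^sup>2 - (ramp y)\<^sup>2) / (z - y) - 2 * ramp y\<bar>
          \<le> (z - y)\<^sup>2 / \<bar>z - y\<bar>"
        by (simp add: abs_divide divide_right_mono)
      also have "\<dots> = \<bar>z - y\<bar>"
        using z abs_mult_self_eq[of "z - y"]
        by (simp add: power2_eq_square nonzero_divide_eq_eq del: abs_mult_self_eq)
      finally show ?thesis
        using z by (simp add: dist_real_def)
    qed
    then show "\<exists>s>0. \<forall>z. z \<noteq> y \<and> dist z y < s \<longrightarrow>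
       dist (((ramp z)\<^sup>2 - (ramp y)\<^sup>2) / (z - y)) (2 * ramp y) < e"
      using e by blast
  qed
  from DERIV_chain2[OF this assms] show ?thesis .
qed

lemma has_real_derivative_smooth_step:
  assumes "h \<noteq> 0"
  shows "((\<lambda>x. smooth_step ((x - s) / h)) has_real_derivative tent ((x - s) / h) / h) (at x)"
proof -
  have D: "((\<lambda>x. (ramp ((x - s) / h - c))\<^sup>2) has_real_derivative
      2 * ramp ((x - s) / h - c) * (1 / h)) (at x)" for c
    by (intro has_real_derivative_ramp_square) (auto intro!: derivative_eq_intros simp: assms)
  have "((\<lambda>x. smooth_step ((x - s) / h)) has_real_derivative
      (2 * ramp ((x - s) / h) * (1 / h) - 2 * (2 * ramp ((x - s) / h - 1) * (1 / h))
        + 2 * ramp ((x - s) / h - 2) * (1 / h)) / 2) (at x)"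
    unfolding smooth_step_def
    using D[of 0] D[of 1] D[of 2] by (intro DERIV_cdivide DERIV_add DERIV_diff DERIV_cmult) auto
  moreover have "(2 * ramp ((x - s) / h) * (1 / h) - 2 * (2 * ramp ((x - s) / h - 1) * (1 / h))
        + 2 * ramp ((x - s) / h - 2) * (1 / h)) / 2 = tent ((x - s) / h) / h"
    by (simp add: tent_def add_divide_distrib diff_divide_distrib)
  ultimately show ?thesis by simp
qed

lemma tent_nonneg: "tent x \<ge> 0"
  by (auto simp: tent_def ramp_def max_def)

lemma tent_eq_0: "x \<le> 0 \<or> x \<ge> 2 \<Longrightarrow> tent x = 0"
  by (auto simp: tent_def ramp_def max_def)

lemma continuous_on_tent: "continuous_on A f \<Longrightarrow> continuous_on A (\<lambda>x. tent (f x))"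
  unfolding tent_def ramp_def by (intro continuous_intros)

lemma smooth_step_left: "x \<le> 0 \<Longrightarrow> smooth_step x = 0"
  by (simp add: smooth_step_def ramp_def max_def)

lemma smooth_step_right: "x \<ge> 2 \<Longrightarrow> smooth_step x = 1"
  by (simp add: smooth_step_def ramp_def max_def power2_eq_square algebra_simps)

lemma mono_smooth_step: "x \<le> y \<Longrightarrow> smooth_step x \<le> smooth_step y"
proof (erule DERIV_nonneg_imp_nondecreasing)
  fix z :: real
  show "\<exists>D. (smooth_step has_real_derivative D) (at z) \<and> 0 \<le> D"
    using has_real_derivative_smooth_step[of 1 0 z] tent_nonneg[of z] by auto
qed

lemma smooth_step_range: "0 \<le> smooth_step x" "smooth_step x \<le> 1"
  using mono_smooth_step[of "min x 0" x] mono_smooth_step[of x "max x 2"]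
  by (auto simp: smooth_step_left smooth_step_right)

lemma integral_tent:
  assumes "h > 0" "s \<ge> 0" "s + 2 * h \<le> \<epsilon>"
  shows "(LINT x|lebesgue_on {0..\<epsilon>}. tent ((x - s) / h) / h) = 1"
proof -
  have "((\<lambda>x. tent ((x - s) / h) / h) has_integral
      smooth_step ((\<epsilon> - s) / h) - smooth_step ((0 - s) / h)) {0..\<epsilon>}"
    using assms has_real_derivative_smooth_step[of h s]
    by (intro fundamental_theorem_of_calculus)
       (auto simp: has_real_derivative_iff_has_vector_derivative[symmetric]
             intro: has_field_derivative_at_within)
  moreover have "smooth_step ((\<epsilon> - s) / h) - smooth_step ((0 - s) / h) = 1"
    using assms by (simp add: smooth_step_left smooth_step_right field_simps)
  ultimately have "integral {0..\<epsilon>} (\<lambda>x. tent ((x - s) / h) / h) = 1"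
    by (metis integral_unique)
  moreover have "integrable (lebesgue_on {0..\<epsilon>}) (\<lambda>x. tent ((x - s) / h) / h)"
    using assms by (intro continuous_imp_integrable_real continuous_intros continuous_on_tent) auto
  ultimately show ?thesis
    using lebesgue_integral_eq_integral[of "{0..\<epsilon>}" "\<lambda>x. tent ((x - s) / h) / h"] by simp
qed

text \<open>The rescaled hat is a probability density carried by [s, s + 2h], so the integral is a
  weighted mean of values of \<open>w\<close> within \<eta> of \<open>c\<close>.\<close>

lemma integral_mult_tent_approx:
  assumes "h > 0" "s \<ge> 0" "s + 2 * h \<le> \<epsilon>" and w: "continuous_on {0..\<epsilon>} w"
    and near: "\<And>x. x \<in> {s..s + 2 * h} \<Longrightarrow> \<bar>w x - c\<bar> \<le> \<eta>"
  shows "integrable (lebesgue_on {0..\<epsilon>}) (\<lambda>x. w x * (tent ((x - s) / h) / h))"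
    and "\<bar>(LINT x|lebesgue_on {0..\<epsilon>}. w x * (tent ((x - s) / h) / h)) - c\<bar> \<le> \<eta>"
proof -
  let ?M = "lebesgue_on {0..\<epsilon>}" and ?\<rho> = "\<lambda>x. tent ((x - s) / h) / h"
  have i: "integrable ?M ?\<rho>"
    using assms by (intro continuous_imp_integrable_real continuous_intros continuous_on_tent) auto
  show iw: "integrable ?M (\<lambda>x. w x * ?\<rho> x)"
    using assms by (intro continuous_imp_integrable_real continuous_intros continuous_on_tent) auto
  have one: "integral\<^sup>L ?M ?\<rho> = 1"
    using assms by (intro integral_tent)
  have "(LINT x|?M. w x * ?\<rho> x) - c = (LINT x|?M. w x * ?\<rho> x) - (LINT x|?M. c * ?\<rho> x)"
    using one by simp
  also have "\<dots> = (LINT x|?M. (w x - c) * ?\<rho> x)"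
    unfolding left_diff_distrib
    by (rule Bochner_Integration.integral_diff[symmetric, OF iw integrable_mult_right[OF i]])
  also have "\<bar>\<dots>\<bar> \<le> (LINT x|?M. \<eta> * ?\<rho> x)"
  proof -
    have "\<bar>(w x - c) * ?\<rho> x\<bar> \<le> \<eta> * ?\<rho> x" for x
    proof (cases "x \<in> {s..s + 2 * h}")
      case True
      then show ?thesis
        using near[of x] tent_nonneg[of "(x - s) / h"] assms(1)
        by (auto simp: abs_mult intro!: divide_right_mono mult_right_mono)
    next
      case False
      then have "(x - s) / h \<le> 0 \<or> (x - s) / h \<ge> 2"
        using assms(1) by (auto simp: field_simps)
      then show ?thesis by (auto simp: tent_eq_0)
    qed
    moreover have "integrable ?M (\<lambda>x. (w x - c) * ?\<rho> x)"
      using assms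
      by (intro continuous_imp_integrable_real continuous_intros continuous_on_tent) auto
    ultimately have "norm (LINT x|?M. (w x - c) * ?\<rho> x) \<le> (LINT x|?M. \<eta> * ?\<rho> x)"
      using i by (intro Bochner_Integration.integral_norm_bound_integral integrable_mult_right)
        (simp_all only: real_norm_def)
    then show ?thesis by simp
  qed
  finally show "\<bar>(LINT x|?M. w x * ?\<rho> x) - c\<bar> \<le> \<eta>"
    using one by simp
qed

section \<open>From the weak derivative to pointwise differences\<close>

lemma Lp_interval_2_iff:
  "f \<in> Lp_interval \<epsilon> 2 \<longleftrightarrow> f \<in> borel_measurable (lebesgue_on {0..\<epsilon>}) \<and>
    integrable (lebesgue_on {0..\<epsilon>}) (\<lambda>t. (f t)\<^sup>2)"
  by (simp add: Lp_interval_def)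

lemma Lp_interval_2_L1:
  assumes "\<epsilon> > 0" and "f \<in> Lp_interval \<epsilon> 2"
  shows "integrable (lebesgue_on {0..\<epsilon>}) f"
    and "(LINT t|lebesgue_on {0..\<epsilon>}. \<bar>f t\<bar>)\<^sup>2 \<le> \<epsilon> * (LINT t|lebesgue_on {0..\<epsilon>}. (f t)\<^sup>2)"
proof -
  let ?M = "lebesgue_on {0..\<epsilon>}"
  have f: "f \<in> borel_measurable ?M" "integrable ?M (\<lambda>t. (f t)\<^sup>2)"
    using assms(2) by (auto simp: Lp_interval_2_iff)
  have const: "integrable ?M (\<lambda>_. c :: real)" for c
    by (intro continuous_imp_integrable_real continuous_intros)
  have "\<bar>y\<bar> \<le> 1 + y\<^sup>2" for y :: real
    using sum_squares_bound[of "\<bar>y\<bar>" 1] by (simp add: power2_eq_square)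
  then show i: "integrable ?M f"
    using f by (intro Bochner_Integration.integrable_bound[OF Bochner_Integration.integrable_add[OF const f(2), of 1]]) auto
  \<comment> \<open>The mean of |f|. Nonnegativity of the variance of |f| is then the Cauchy-Schwarz
    inequality against the constant 1.\<close>
  define m where "m = (LINT t|?M. \<bar>f t\<bar>) / \<epsilon>"
  have "0 \<le> (LINT t|?M. (\<bar>f t\<bar> - m)\<^sup>2)"
    by (intro integral_nonneg_AE) auto
  also have "\<dots> = (LINT t|?M. (f t)\<^sup>2 - 2 * m * \<bar>f t\<bar> + m\<^sup>2)"
    by (intro Bochner_Integration.integral_cong) (auto simp: power2_diff)
  also have "\<dots> = (LINT t|?M. (f t)\<^sup>2) - 2 * m * (LINT t|?M. \<bar>f t\<bar>) + \<epsilon> * m\<^sup>2"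
    using f i const[of "m\<^sup>2"] assms(1)
    by (simp add: integrable_abs measure_restrict_space)
  also have "\<dots> = (LINT t|?M. (f t)\<^sup>2) - (LINT t|?M. \<bar>f t\<bar>)\<^sup>2 / \<epsilon>"
    using assms(1) by (simp add: m_def power2_eq_square field_simps)
  finally show "(LINT t|?M. \<bar>f t\<bar>)\<^sup>2 \<le> \<epsilon> * (LINT t|?M. (f t)\<^sup>2)"
    using assms(1) by (simp add: field_simps)
qed

text \<open>Left of \<open>s\<close> both steps are 0 and right of t + 2h both are 1, so the
  difference is compactly supported in the open interval. Its derivative is a difference of two
  densities, which turns testing into a comparison of local means.\<close>

lemma smooth_step_diff_test_function:
  assumes "h > 0" "0 < s" "s \<le> t" "t + 2 * h < \<epsilon>"
  defines "\<phi> \<equiv> \<lambda>x. smooth_step ((x - s) / h) - smooth_step ((x - t) / h)"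
  shows "\<phi> \<in> test_functions \<epsilon>"
    and "deriv \<phi> = (\<lambda>x. tent ((x - s) / h) / h - tent ((x - t) / h) / h)"
proof -
  have D: "(\<phi> has_real_derivative tent ((x - s) / h) / h - tent ((x - t) / h) / h) (at x)" for x
    unfolding \<phi>_def by (intro DERIV_diff has_real_derivative_smooth_step) (use assms(1) in auto)
  show deriv: "deriv \<phi> = (\<lambda>x. tent ((x - s) / h) / h - tent ((x - t) / h) / h)"
    using DERIV_imp_deriv[OF D] by (intro ext)
  have "\<phi> x = 0" if x: "x \<notin> {s..t + 2 * h}" for x
  proof -
    consider "x < s" | "x > t + 2 * h" using x by (auto simp: not_le)
    then show ?thesis
    proof cases
      case 1
      then have "(x - s) / h \<le> 0" "(x - t) / h \<le> 0"
        using assms by (auto simp: divide_le_0_iff)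
      then show ?thesis by (simp add: \<phi>_def smooth_step_left)
    next
      case 2
      then have "(x - s) / h \<ge> 2" "(x - t) / h \<ge> 2"
        using assms by (auto simp: field_simps)
      then show ?thesis by (simp add: \<phi>_def smooth_step_right)
    qed
  qed
  moreover have "continuous_on UNIV (deriv \<phi>)"
    unfolding deriv using assms(1) by (intro continuous_intros continuous_on_tent) auto
  moreover have "{s..t + 2 * h} \<subseteq> {0<..<\<epsilon>}"
    using assms by auto
  ultimately show "\<phi> \<in> test_functions \<epsilon>"
    unfolding test_functions_def field_differentiable_def using D compact_Icc by blast
qed

text \<open>
  Testing with a smoothed indicator of \<open>[s, t]\<close> compares the averages of \<open>w\<close> near \<open>s\<close> and \<open>t\<close>.
\<close>

lemma weak_deriv_oscillation_open:
  assumes "\<epsilon> > 0" and w: "continuous_on {0..\<epsilon>} w"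
    and g: "integrable (lebesgue_on {0..\<epsilon>}) g" and wg: "weak_deriv_interval \<epsilon> w g"
    and st: "0 < s" "s \<le> t" "t < \<epsilon>"
  shows "\<bar>w s - w t\<bar> \<le> (LINT x|lebesgue_on {0..\<epsilon>}. \<bar>g x\<bar>)"
proof (rule field_le_epsilon)
  fix e :: real assume e: "e > 0"
  let ?M = "lebesgue_on {0..\<epsilon>}"
  have near: "\<exists>d>0. \<forall>y\<in>{0..\<epsilon>}. dist y x < d \<longrightarrow> dist (w y) (w x) < e / 2" if "x \<in> {0..\<epsilon>}" for x
    using w that e unfolding continuous_on_iff by (meson half_gt_zero)
  obtain ds where ds: "ds > 0" "\<And>y. y \<in> {0..\<epsilon>} \<Longrightarrow> dist y s < ds \<Longrightarrow> dist (w y) (w s) < e / 2"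
    using near[of s] st by auto
  obtain dt where dt: "dt > 0" "\<And>y. y \<in> {0..\<epsilon>} \<Longrightarrow> dist y t < dt \<Longrightarrow> dist (w y) (w t) < e / 2"
    using near[of t] st by auto
  \<comment> \<open>Dividing by 3 keeps 2h strictly below all three gaps: the second bump stays
    inside the interval, and each bump stays within the continuity radius of its point.\<close>
  define h where "h = min (\<epsilon> - t) (min ds dt) / 3"
  have h: "h > 0" "t + 2 * h < \<epsilon>" "2 * h < ds" "2 * h < dt"
    using ds dt st by (auto simp: h_def min_def field_simps)
  let ?\<phi> = "\<lambda>x. smooth_step ((x - s) / h) - smooth_step ((x - t) / h)"
  have ws: "\<bar>w x - w s\<bar> \<le> e / 2" if "x \<in> {s..s + 2 * h}" for x
    using ds(2)[of x] that h st by (simp add: dist_real_def)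
  have wt: "\<bar>w x - w t\<bar> \<le> e / 2" if "x \<in> {t..t + 2 * h}" for x
    using dt(2)[of x] that h st by (simp add: dist_real_def)
  have range: "0 \<le> s" "s + 2 * h \<le> \<epsilon>" "0 \<le> t" "t + 2 * h \<le> \<epsilon>"
    using h st by auto
  note int = integral_mult_tent_approx[OF h(1) range(1,2) w ws]
    integral_mult_tent_approx[OF h(1) range(3,4) w wt]
  have "(LINT x|?M. w x * (tent ((x - s) / h) / h)) - (LINT x|?M. w x * (tent ((x - t) / h) / h))
      = (LINT x|?M. w x * deriv ?\<phi> x)"
    by (subst smooth_step_diff_test_function(2)[OF h(1) st(1,2) h(2)])
       (simp only: right_diff_distrib Bochner_Integration.integral_diff[OF int(1,3)])
  also have "\<dots> = - (LINT x|?M. g x * ?\<phi> x)"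
    using wg smooth_step_diff_test_function(1)[OF h(1) st(1,2) h(2)]
    unfolding weak_deriv_interval_def by blast
  also have "\<bar>\<dots>\<bar> \<le> (LINT x|?M. \<bar>g x\<bar>)"
  proof -
    have \<phi>1: "\<bar>?\<phi> x\<bar> \<le> 1" for x
      using smooth_step_range[of "(x - s) / h"] smooth_step_range[of "(x - t) / h"] by linarith
    have "\<bar>g x * ?\<phi> x\<bar> \<le> \<bar>g x\<bar>" for x
      using mult_left_mono[OF \<phi>1[of x], of "\<bar>g x\<bar>"] by (simp add: abs_mult)
    moreover have "integrable ?M (\<lambda>x. \<bar>g x\<bar>)"
      using g by simp
    ultimately have "(LINT x|?M. \<bar>g x * ?\<phi> x\<bar>) \<le> (LINT x|?M. \<bar>g x\<bar>)"
      by (intro integral_mono') auto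
    then have "\<bar>LINT x|?M. g x * ?\<phi> x\<bar> \<le> (LINT x|?M. \<bar>g x\<bar>)"
      using integral_abs_bound[of ?M "\<lambda>x. g x * ?\<phi> x"] by (rule order_trans[rotated])
    then show ?thesis by simp
  qed
  finally show "\<bar>w s - w t\<bar> \<le> (LINT x|?M. \<bar>g x\<bar>) + e"
    using int(2,4) by linarith
qed

text \<open>Test functions vanish near 0 and \<epsilon>, so testing reaches interior points only.
  The endpoints, which are the vertices of the grid, follow by continuity in one variable at a time;
  Cauchy-Schwarz then passes from L^1 to L^2 at the cost of the length \<epsilon>.\<close>

lemma weak_deriv_oscillation:
  assumes "\<epsilon> > 0" and w: "continuous_on {0..\<epsilon>} w"
    and g: "g \<in> Lp_interval \<epsilon> 2" and wg: "weak_deriv_interval \<epsilon> w g"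
    and "s \<in> {0..\<epsilon>}" "t \<in> {0..\<epsilon>}"
  shows "(w s - w t)\<^sup>2 \<le> \<epsilon> * (LINT x|lebesgue_on {0..\<epsilon>}. (g x)\<^sup>2)"
proof -
  let ?G = "LINT x|lebesgue_on {0..\<epsilon>}. \<bar>g x\<bar>"
  have cl: "closure {0<..<\<epsilon>} = {0..\<epsilon>}"
    using assms(1) by (simp add: closure_greaterThanLessThan)
  have ordered: "\<bar>w s - w t\<bar> \<le> ?G" if "0 < s" "s \<le> t" "t < \<epsilon>" for s t
    using weak_deriv_oscillation_open[OF assms(1) w Lp_interval_2_L1(1)[OF assms(1) g] wg that] .
  have inner: "\<bar>w s - w t\<bar> \<le> ?G" if "s \<in> {0<..<\<epsilon>}" "t \<in> {0<..<\<epsilon>}" for s t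
    using ordered[of s t] ordered[of t s] that
    by (cases "s \<le> t") (simp_all add: abs_minus_commute[of "w s"])
  have half: "\<bar>w s - w t\<bar> \<le> ?G" if s: "s \<in> {0<..<\<epsilon>}" and t: "t \<in> {0..\<epsilon>}" for s t
  proof (rule continuous_le_on_closure[of "{0<..<\<epsilon>}" "\<lambda>t. \<bar>w s - w t\<bar>"])
    show "continuous_on (closure {0<..<\<epsilon>}) (\<lambda>t. \<bar>w s - w t\<bar>)"
      unfolding cl by (intro continuous_intros w)
  qed (use s t cl inner in auto)
  have "\<bar>w s - w t\<bar> \<le> ?G"
  proof (rule continuous_le_on_closure[of "{0<..<\<epsilon>}" "\<lambda>s. \<bar>w s - w t\<bar>"])
    show "continuous_on (closure {0<..<\<epsilon>}) (\<lambda>s. \<bar>w s - w t\<bar>)"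
      unfolding cl by (intro continuous_intros w)
    show "\<bar>w s - w t\<bar> \<le> ?G" if "s \<in> {0<..<\<epsilon>}" for s
      using half that assms by blast
  qed (use assms cl in auto)
  then have "\<bar>w s - w t\<bar>\<^sup>2 \<le> ?G\<^sup>2"
    by (intro power_mono) auto
  also have "\<dots> \<le> \<epsilon> * (LINT x|lebesgue_on {0..\<epsilon>}. (g x)\<^sup>2)"
    by (rule Lp_interval_2_L1(2)[OF assms(1) g])
  finally show ?thesis by simp
qed

section \<open>From the lattice to the metric graph\<close>

lemma edge_path_in_grid:
  assumes "\<epsilon> > 0" and "t \<in> {0..\<epsilon>}"
  shows "edge_path \<epsilon> e t \<in> grid \<epsilon>"
  using bij_betw_edge_path[OF assms(1)] assms(2) unfolding grid_def bij_betw_def by blast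

lemma continuous_on_on_edges:
  assumes "\<epsilon> > 0" and "u \<in> H1_grid \<epsilon>"
  shows "continuous_on {0..\<epsilon>} (on_edges \<epsilon> u e)"
proof -
  have "continuous_on {0..\<epsilon>} (\<lambda>t. edge_path \<epsilon> e t)"
    unfolding edge_path_def by (intro continuous_intros)
  moreover have "continuous_on (grid \<epsilon>) u"
    using assms(2) by (simp add: H1_grid_def)
  ultimately show ?thesis
    unfolding on_edges_def
    using continuous_on_compose2[of "grid \<epsilon>" u "{0..\<epsilon>}" "edge_path \<epsilon> e"]
      edge_path_in_grid[OF assms(1)] by blast
qed

lemma on_edges_0: "on_edges \<epsilon> u (k, i) 0 = u (grid_vertex \<epsilon> k)"
  by (simp add: on_edges_def edge_path_def)

lemma on_edges_end: "on_edges \<epsilon> u (k, i) \<epsilon> = u (grid_vertex \<epsilon> (k + axis i 1))"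
proof -
  have "edge_path \<epsilon> (k, i) \<epsilon> = grid_vertex \<epsilon> (k + axis i 1)"
    by (simp add: vec_eq_iff edge_path_def grid_vertex_def axis_def algebra_simps)
  then show ?thesis by (simp add: on_edges_def)
qed

text \<open>Membership in \<open>H1_interval\<close> supplies a witness, so the choice made by
  \<open>SOME\<close> in \<open>grid_deriv\<close> has the intended properties.\<close>

lemma grid_deriv_weak_deriv:
  assumes "u \<in> H1_grid \<epsilon>"
  shows "grid_deriv \<epsilon> u e \<in> Lp_interval \<epsilon> 2"
    and "weak_deriv_interval \<epsilon> (on_edges \<epsilon> u e) (grid_deriv \<epsilon> u e)"
proof -
  have "\<exists>g. g \<in> Lp_interval \<epsilon> 2 \<and> weak_deriv_interval \<epsilon> (on_edges \<epsilon> u e) g"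
    using assms unfolding H1_grid_def H1_interval_def by blast
  from someI_ex[OF this]
  show "grid_deriv \<epsilon> u e \<in> Lp_interval \<epsilon> 2"
    and "weak_deriv_interval \<epsilon> (on_edges \<epsilon> u e) (grid_deriv \<epsilon> u e)"
    unfolding grid_deriv_def by blast+
qed

definition edge_energy :: "real \<Rightarrow> ('n::finite edge \<Rightarrow> real \<Rightarrow> real) \<Rightarrow> 'n edge \<Rightarrow> real" where
  "edge_energy \<epsilon> f e = (LINT t|lebesgue_on {0..\<epsilon>}. (f e t)\<^sup>2)"

lemma edge_energy_nonneg: "edge_energy \<epsilon> f e \<ge> 0"
  unfolding edge_energy_def by (intro integral_nonneg_AE) auto

lemma edge_oscillation:
  assumes "\<epsilon> > 0" and "u \<in> H1_grid \<epsilon>" and "s \<in> {0..\<epsilon>}" "t \<in> {0..\<epsilon>}"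
  shows "(on_edges \<epsilon> u e s - on_edges \<epsilon> u e t)\<^sup>2 \<le> \<epsilon> * edge_energy \<epsilon> (grid_deriv \<epsilon> u) e"
  unfolding edge_energy_def
  by (intro weak_deriv_oscillation assms continuous_on_on_edges grid_deriv_weak_deriv)

lemma Lp_grid_2_summable: "f \<in> Lp_grid \<epsilon> 2 \<Longrightarrow> edge_energy \<epsilon> f summable_on UNIV"
  unfolding edge_energy_def by (simp add: Lp_grid_def)

lemma Lp_grid_norm_2: "Lp_grid_norm \<epsilon> 2 f = sqrt (\<Sum>\<^sub>\<infinity>e. edge_energy \<epsilon> f e)"
  by (simp add: Lp_grid_norm_def edge_energy_def powr_half_sqrt infsum_nonneg)

text \<open>The inclusion of l^2 in l^q: single terms satisfy f(x)^2 <= B, so all but two of the q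
  factors are bounded by a constant.\<close>

lemma summable_on_powr_of_square:
  fixes f :: "'a \<Rightarrow> real"
  assumes "q \<ge> 2" and "0 \<le> B" and "\<And>A. finite A \<Longrightarrow> (\<Sum>x\<in>A. (f x)\<^sup>2) \<le> B"
  shows "(\<lambda>x. \<bar>f x\<bar> powr q) summable_on UNIV"
proof (rule nonneg_bdd_above_summable_on)
  have fB: "\<bar>f x\<bar> powr q \<le> B powr ((q - 2) / 2) * (f x)\<^sup>2" for x
  proof (cases "f x = 0")
    case False
    have "\<bar>f x\<bar> powr q = ((f x)\<^sup>2) powr ((q - 2) / 2) * (f x)\<^sup>2"
      using False powr_add[of "\<bar>f x\<bar>" "q - 2" 2] power2_powr_half[of "\<bar>f x\<bar>" "q - 2"] by simp
    also have "\<dots> \<le> B powr ((q - 2) / 2) * (f x)\<^sup>2"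
      using assms(1) assms(3)[of "{x}"] by (intro mult_right_mono powr_mono2) auto
    finally show ?thesis .
  qed simp
  show "bdd_above (sum (\<lambda>x. \<bar>f x\<bar> powr q) ` {F. F \<subseteq> UNIV \<and> finite F})"
  proof (rule bdd_aboveI2)
    fix F :: "'a set" assume "F \<in> {F. F \<subseteq> UNIV \<and> finite F}"
    then have F: "finite F" by simp
    have "(\<Sum>x\<in>F. \<bar>f x\<bar> powr q) \<le> B powr ((q - 2) / 2) * (\<Sum>x\<in>F. (f x)\<^sup>2)"
      unfolding sum_distrib_left by (intro sum_mono fB)
    also have "\<dots> \<le> B powr ((q - 2) / 2) * B"
      using assms(3)[OF F] by (intro mult_left_mono) auto
    finally show "(\<Sum>x\<in>F. \<bar>f x\<bar> powr q) \<le> B powr ((q - 2) / 2) * B" .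
  qed
qed auto

lemma add_powr_le:
  fixes a b p :: real
  assumes "a \<ge> 0" "b \<ge> 0" "p \<ge> 0"
  shows "(a + b) powr p \<le> 2 powr p * (a powr p + b powr p)"
proof -
  have "(a + b) powr p \<le> (2 * max a b) powr p"
    using assms by (intro powr_mono2) auto
  also have "\<dots> = 2 powr p * (max a b) powr p"
    using assms by (simp add: powr_mult)
  also have "\<dots> \<le> 2 powr p * (a powr p + b powr p)"
    by (intro mult_left_mono) (auto simp: max_def)
  finally show ?thesis .
qed

lemma sqrt_powr: "z \<ge> 0 \<Longrightarrow> sqrt z powr p = z powr (p / 2)" for z p :: real
  by (simp add: powr_half_sqrt[symmetric] powr_powr)

text \<open>
  The vertex values satisfy the discrete Sobolev inequality, and on each edge the function differs
  from a vertex value by at most \<open>sqrt \<epsilon>\<close> times the norm of the derivative.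
\<close>

locale grid_function =
  fixes \<epsilon> :: real and u :: "real ^ 'n::finite \<Rightarrow> real"
  assumes eps: "\<epsilon> > 0" and u: "u \<in> H1_grid \<epsilon>"
begin

abbreviation w :: "'n edge \<Rightarrow> real \<Rightarrow> real" where "w \<equiv> on_edges \<epsilon> u"
abbreviation E :: "'n edge \<Rightarrow> real" where "E \<equiv> edge_energy \<epsilon> (grid_deriv \<epsilon> u)"

definition vertex_value :: "int ^ 'n \<Rightarrow> real" where
  "vertex_value k = u (grid_vertex \<epsilon> k)"

text \<open>The common bound for squared oscillations along edges and for the squared l^2 norm of
  vertex differences in one direction; its factor \<epsilon> is the source of most powers of
  \<epsilon> in the theorem.\<close>

definition M :: real where "M = \<epsilon> * (\<Sum>\<^sub>\<infinity>e. E e)"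
definition U :: real where "U = (\<Sum>\<^sub>\<infinity>e. edge_energy \<epsilon> w e)"

lemma summable: "E summable_on UNIV" "edge_energy \<epsilon> w summable_on UNIV"
  using u by (auto simp: H1_grid_def intro: Lp_grid_2_summable)

lemma nonneg: "M \<ge> 0" "U \<ge> 0"
  using eps by (auto simp: M_def U_def edge_energy_nonneg intro!: infsum_nonneg mult_nonneg_nonneg)

lemma sum_E_le: "finite A \<Longrightarrow> (\<Sum>e\<in>A. \<epsilon> * E e) \<le> M"
  unfolding M_def sum_distrib_left[symmetric] using eps summable
  by (intro mult_left_mono finite_sum_le_infsum) (auto simp: edge_energy_nonneg)

lemma sum_U_le: "finite A \<Longrightarrow> (\<Sum>e\<in>A. edge_energy \<epsilon> w e) \<le> U"
  unfolding U_def using summable by (intro finite_sum_le_infsum) (auto simp: edge_energy_nonneg)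

lemma integrable_square: "integrable (lebesgue_on {0..\<epsilon>}) (\<lambda>t. (w e t)\<^sup>2)"
  by (intro continuous_imp_integrable_real continuous_intros continuous_on_on_edges eps u)

lemma integrable_powr:
  assumes "p > 0"
  shows "integrable (lebesgue_on {0..\<epsilon>}) (\<lambda>t. \<bar>w e t\<bar> powr p)"
  using assms
  by (intro continuous_imp_integrable_real continuous_on_powr' continuous_intros
      continuous_on_on_edges eps u) auto

lemma oscillation:
  assumes "s \<in> {0..\<epsilon>}" "t \<in> {0..\<epsilon>}"
  shows "\<bar>w e s\<bar> \<le> \<bar>w e t\<bar> + sqrt (\<epsilon> * E e)"
proof -
  have "\<bar>w e s - w e t\<bar> \<le> sqrt (\<epsilon> * E e)"
    using edge_oscillation[OF eps u assms] by (intro real_le_rsqrt) auto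
  then show ?thesis by linarith
qed

text \<open>A unit step from \<open>k\<close> in direction \<open>i\<close> joins the two ends of
  the edge \<open>(k, i)\<close>. Different \<open>k\<close> give different edges, so the squared
  oscillations add up to at most \<open>M\<close>.\<close>

lemma shift_bound_vertex_value: "shift_bound vertex_value (axis i 1) (sqrt M)"
  unfolding shift_bound_def L2_set_def
proof (intro allI impI real_sqrt_le_mono)
  fix A :: "(int ^ 'n) set"
  assume A: "finite A"
  have "(\<Sum>k\<in>A. (vertex_value (k + axis i 1) - vertex_value k)\<^sup>2) \<le> (\<Sum>k\<in>A. \<epsilon> * E (k, i))"
    using edge_oscillation[OF eps u, of \<epsilon> 0 "(_, i)"] eps
    by (intro sum_mono) (simp add: vertex_value_def on_edges_0 on_edges_end)
  also have "\<dots> = (\<Sum>e\<in>(\<lambda>k. (k, i)) ` A. \<epsilon> * E e)"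
    by (subst sum.reindex) (auto simp: inj_on_def)
  also have "\<dots> \<le> M"
    using A by (intro sum_E_le) auto
  finally show "(\<Sum>k\<in>A. (vertex_value (k + axis i 1) - vertex_value k)\<^sup>2) \<le> M" .
qed

text \<open>The vertex value is compared with the value at every \<open>t\<close> on the edge and
  the comparison is integrated over \<open>t\<close>. It serves only to show that the vertex values
  are square summable.\<close>

lemma vertex_value_square_le:
  "\<epsilon> * (vertex_value k)\<^sup>2 \<le> 2 * edge_energy \<epsilon> w (k, i) + 2 * \<epsilon> * (\<epsilon> * E (k, i))"
proof -
  let ?M = "lebesgue_on {0..\<epsilon>}"
  have const: "integrable ?M (\<lambda>_. c :: real)" for c
    by (intro continuous_imp_integrable_real continuous_intros)
  have pt: "(vertex_value k)\<^sup>2 \<le> 2 * (w (k, i) t)\<^sup>2 + 2 * (\<epsilon> * E (k, i))" if "t \<in> {0..\<epsilon>}" for t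
  proof -
    have "(vertex_value k)\<^sup>2 = (w (k, i) t + (w (k, i) 0 - w (k, i) t))\<^sup>2"
      by (simp add: vertex_value_def on_edges_0)
    also have "\<dots> \<le> 2 * ((w (k, i) t)\<^sup>2 + (w (k, i) 0 - w (k, i) t)\<^sup>2)"
      using zero_le_power2[of "w (k, i) t - (w (k, i) 0 - w (k, i) t)"]
      by (simp add: power2_eq_square algebra_simps)
    also have "\<dots> \<le> 2 * (w (k, i) t)\<^sup>2 + 2 * (\<epsilon> * E (k, i))"
      using edge_oscillation[OF eps u, of 0 t "(k, i)"] that eps by simp
    finally show ?thesis .
  qed
  have "\<epsilon> * (vertex_value k)\<^sup>2 = (LINT t|?M. (vertex_value k)\<^sup>2)"
    using eps by (simp add: measure_restrict_space)
  also have "\<dots> \<le> (LINT t|?M. 2 * (w (k, i) t)\<^sup>2 + 2 * (\<epsilon> * E (k, i)))"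
    by (intro integral_mono const Bochner_Integration.integrable_add integrable_mult_right
        integrable_square) (use pt in auto)
  also have "\<dots> = 2 * edge_energy \<epsilon> w (k, i) + \<epsilon> * (2 * (\<epsilon> * E (k, i)))"
    using eps
    by (subst Bochner_Integration.integral_add)
       (auto simp: edge_energy_def measure_restrict_space intro!: integrable_square const)
  finally show ?thesis by (simp add: mult_ac)
qed

lemma summable_vertex_value:
  assumes "q \<ge> 2"
  shows "(\<lambda>k. \<bar>vertex_value k\<bar> powr q) summable_on UNIV"
proof (rule summable_on_powr_of_square[OF assms])
  show "0 \<le> (2 * U + 2 * \<epsilon> * M) / \<epsilon>"
    using nonneg eps by simp
  fix A :: "(int ^ 'n) set"
  assume A: "finite A"
  \<comment> \<open>An arbitrary direction, which assigns to each vertex one edge leaving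
    it.\<close>
  fix i :: 'n
  let ?A = "(\<lambda>k. (k, i)) ` A"
  have re: "(\<Sum>k\<in>A. h (k, i)) = (\<Sum>e\<in>?A. h e)" for h :: "'n edge \<Rightarrow> real"
    by (subst sum.reindex) (auto simp: inj_on_def)
  have "\<epsilon> * (\<Sum>k\<in>A. (vertex_value k)\<^sup>2)
      \<le> (\<Sum>k\<in>A. 2 * edge_energy \<epsilon> w (k, i) + 2 * \<epsilon> * (\<epsilon> * E (k, i)))"
    unfolding sum_distrib_left by (intro sum_mono vertex_value_square_le)
  also have "\<dots> = 2 * (\<Sum>e\<in>?A. edge_energy \<epsilon> w e) + 2 * \<epsilon> * (\<Sum>e\<in>?A. \<epsilon> * E e)"
    unfolding sum.distrib sum_distrib_left[symmetric] by (simp only: re)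
  also have "\<dots> \<le> 2 * U + 2 * \<epsilon> * M"
    using A eps by (intro add_mono mult_left_mono sum_U_le sum_E_le) auto
  finally show "(\<Sum>k\<in>A. (vertex_value k)\<^sup>2) \<le> (2 * U + 2 * \<epsilon> * M) / \<epsilon>"
    using eps by (simp add: field_simps)
qed

text \<open>The two estimates are the endpoints \<alpha> = 0 and \<alpha> = 2. The first splits
  |w|^q into a vertex part and an oscillation part; the second bounds q - 2 factors by the supremum
  and leaves two for \<open>U\<close>.\<close>

lemma Lq_bounds:
  assumes q: "q > 2" and C: "C > 0"
    and sob: "(\<Sum>\<^sub>\<infinity>k. \<bar>vertex_value k\<bar> powr q) \<le> C * sqrt M powr q"
  shows "w \<in> Lp_grid \<epsilon> q"
    and "(\<Sum>\<^sub>\<infinity>e. LINT t|lebesgue_on {0..\<epsilon>}. \<bar>w e t\<bar> powr q)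
      \<le> 2 powr q * (real CARD('n) * C + 1) * \<epsilon> * M powr (q / 2)"
    and "(\<Sum>\<^sub>\<infinity>e. LINT t|lebesgue_on {0..\<epsilon>}. \<bar>w e t\<bar> powr q)
      \<le> (C powr (1 / q) + 1) powr (q - 2) * M powr (q / 2 - 1) * U"
proof -
  let ?M = "lebesgue_on {0..\<epsilon>}"
  let ?I = "\<lambda>e. LINT t|?M. \<bar>w e t\<bar> powr q"
  have const: "integrable ?M (\<lambda>_. c :: real)" for c
    by (intro continuous_imp_integrable_real continuous_intros)
  have sv: "(\<lambda>k. \<bar>vertex_value k\<bar> powr q) summable_on UNIV"
    using q by (intro summable_vertex_value) auto
  have I0: "?I e \<ge> 0" for e
    by (intro integral_nonneg_AE) auto
  have E0: "\<epsilon> * E e \<ge> 0" for e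
    using eps by (simp add: edge_energy_nonneg)
  have EM: "\<epsilon> * E e \<le> M" for e
    using sum_E_le[of "{e}"] by simp
  have near: "\<bar>w e t\<bar> \<le> \<bar>vertex_value (fst e)\<bar> + sqrt (\<epsilon> * E e)" if "t \<in> {0..\<epsilon>}" for e t
    using oscillation[of t 0 e] that eps on_edges_0[of \<epsilon> u "fst e" "snd e"]
    by (simp add: vertex_value_def)
  have sq: "sqrt M powr q = M powr (q / 2)"
    using nonneg by (simp add: sqrt_powr)
  have I1: "?I e \<le> \<epsilon> * (2 powr q * (\<bar>vertex_value (fst e)\<bar> powr q + (\<epsilon> * E e) powr (q / 2)))" for e
  proof -
    have "?I e \<le> (LINT t|?M. 2 powr q * (\<bar>vertex_value (fst e)\<bar> powr q + (\<epsilon> * E e) powr (q / 2)))"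
    proof (intro integral_mono integrable_powr const)
      fix t assume "t \<in> space ?M"
      then have t: "t \<in> {0..\<epsilon>}" by simp
      have "\<bar>w e t\<bar> powr q \<le> (\<bar>vertex_value (fst e)\<bar> + sqrt (\<epsilon> * E e)) powr q"
        using q near[OF t] by (intro powr_mono2) auto
      also have "\<dots> \<le> 2 powr q * (\<bar>vertex_value (fst e)\<bar> powr q + sqrt (\<epsilon> * E e) powr q)"
        using q E0 by (intro add_powr_le) auto
      finally show "\<bar>w e t\<bar> powr q
          \<le> 2 powr q * (\<bar>vertex_value (fst e)\<bar> powr q + (\<epsilon> * E e) powr (q / 2))"
        using E0 by (simp add: sqrt_powr)
    qed (use q in auto)
    then show ?thesis
      using eps by (simp add: measure_restrict_space)
  qed
  have fin0: "sum ?I F \<le> 2 powr q * (real CARD('n) * C + 1) * \<epsilon> * M powr (q / 2)"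
    if F: "finite F" for F
  proof -
    \<comment> \<open>Each vertex is the starting point of CARD('n) edges, hence the factor CARD('n)
      in the constant.\<close>
    have "(\<Sum>e\<in>F. \<bar>vertex_value (fst e)\<bar> powr q)
        \<le> (\<Sum>e\<in>fst ` F \<times> (UNIV :: 'n set). \<bar>vertex_value (fst e)\<bar> powr q)"
      using F by (intro sum_mono2) (auto intro: rev_image_eqI)
    also have "\<dots> = (\<Sum>k\<in>fst ` F. \<Sum>i\<in>(UNIV :: 'n set). \<bar>vertex_value k\<bar> powr q)"
      by (subst sum.cartesian_product) (simp add: case_prod_beta)
    also have "\<dots> = real CARD('n) * (\<Sum>k\<in>fst ` F. \<bar>vertex_value k\<bar> powr q)"
      by (simp add: sum_distrib_left)
    also have "\<dots> \<le> real CARD('n) * (C * M powr (q / 2))"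
      using F sv sob unfolding sq
      by (intro mult_left_mono order_trans[OF finite_sum_le_infsum]) auto
    finally have V: "(\<Sum>e\<in>F. \<bar>vertex_value (fst e)\<bar> powr q) \<le> real CARD('n) * (C * M powr (q / 2))" .
    \<comment> \<open>One factor is kept because it is summable over edges; the remaining power q/2
      - 1 is bounded by \<open>M\<close>.\<close>
    have Eq: "(\<epsilon> * E e) powr (q / 2) \<le> M powr (q / 2 - 1) * (\<epsilon> * E e)" for e
    proof (cases "\<epsilon> * E e = 0")
      case False
      then have "(\<epsilon> * E e) powr (q / 2) = (\<epsilon> * E e) powr (q / 2 - 1) * (\<epsilon> * E e)"
        using E0[of e] powr_add[of "\<epsilon> * E e" "q / 2 - 1" 1] by simp
      also have "\<dots> \<le> M powr (q / 2 - 1) * (\<epsilon> * E e)"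
        using q E0[of e] EM[of e] by (intro mult_right_mono powr_mono2) auto
      finally show ?thesis .
    qed auto
    have "(\<Sum>e\<in>F. (\<epsilon> * E e) powr (q / 2)) \<le> M powr (q / 2 - 1) * (\<Sum>e\<in>F. \<epsilon> * E e)"
      unfolding sum_distrib_left[of "M powr (q / 2 - 1)"] by (intro sum_mono Eq)
    also have "\<dots> \<le> M powr (q / 2 - 1) * M"
      using F by (intro mult_left_mono sum_E_le) auto
    also have "\<dots> = M powr (q / 2)"
      using nonneg powr_add[of M "q / 2 - 1" 1] by (cases "M = 0") auto
    finally have W: "(\<Sum>e\<in>F. (\<epsilon> * E e) powr (q / 2)) \<le> M powr (q / 2)" .
    have "sum ?I F
        \<le> (\<Sum>e\<in>F. \<epsilon> * (2 powr q * (\<bar>vertex_value (fst e)\<bar> powr q + (\<epsilon> * E e) powr (q / 2))))"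
      by (intro sum_mono I1)
    also have "\<dots> = \<epsilon> * (2 powr q * ((\<Sum>e\<in>F. \<bar>vertex_value (fst e)\<bar> powr q)
        + (\<Sum>e\<in>F. (\<epsilon> * E e) powr (q / 2))))"
      by (simp only: sum_distrib_left[symmetric] sum.distrib)
    also have "\<dots> \<le> \<epsilon> * (2 powr q * (real CARD('n) * (C * M powr (q / 2)) + M powr (q / 2)))"
      using eps by (intro mult_left_mono add_mono V W) auto
    also have "\<dots> = 2 powr q * (real CARD('n) * C + 1) * \<epsilon> * M powr (q / 2)"
      by (simp add: algebra_simps)
    finally show ?thesis .
  qed
  \<comment> \<open>The bound on finite sums yields summability. Without it the infinite sum in the
    L^q norm would be 0 by default and the estimate would be empty.\<close>
  show mem: "w \<in> Lp_grid \<epsilon> q"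
    unfolding Lp_grid_def Lp_interval_def
  proof (intro CollectI conjI allI)
    show "w e \<in> borel_measurable ?M" for e
      by (intro continuous_imp_measurable_on_sets_lebesgue continuous_on_on_edges eps u) auto
    show "integrable ?M (\<lambda>t. \<bar>w e t\<bar> powr q)" for e
      using q by (intro integrable_powr) auto
    show "?I summable_on UNIV"
      by (intro nonneg_bdd_above_summable_on I0 bdd_aboveI2[OF fin0]) auto
  qed
  then have summ: "?I summable_on UNIV"
    by (simp add: Lp_grid_def)
  show "(\<Sum>\<^sub>\<infinity>e. ?I e) \<le> 2 powr q * (real CARD('n) * C + 1) * \<epsilon> * M powr (q / 2)"
    by (intro infsum_le_finite_sums[OF summ] fin0)
  \<comment> \<open>A single term is at most the whole sum, so the discrete Sobolev inequality also
    bounds the supremum of the vertex values.\<close>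
  have vs: "\<bar>vertex_value k\<bar> \<le> C powr (1 / q) * sqrt M" for k
  proof -
    have "\<bar>vertex_value k\<bar> powr q \<le> C * sqrt M powr q"
      using finite_sum_le_infsum[OF sv, of "{k}"] sob by simp
    also have "\<dots> = (C powr (1 / q) * sqrt M) powr q"
      using C q nonneg by (simp add: powr_mult powr_powr)
    finally show ?thesis
      using q nonneg powr_less_mono2[of q "C powr (1 / q) * sqrt M" "\<bar>vertex_value k\<bar>"] by force
  qed
  \<comment> \<open>The supremum over vertices plus one edge oscillation, each a multiple of sqrt
    M.\<close>
  define L where "L = (C powr (1 / q) + 1) * sqrt M"
  have sup: "\<bar>w e t\<bar> \<le> L" if "t \<in> {0..\<epsilon>}" for e t
    using near[OF that, of e] vs[of "fst e"] real_sqrt_le_mono[OF EM[of e]]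
    unfolding L_def distrib_right mult_1 by linarith
  have I2: "?I e \<le> L powr (q - 2) * edge_energy \<epsilon> w e" for e
  proof -
    have "?I e \<le> (LINT t|?M. L powr (q - 2) * (w e t)\<^sup>2)"
    proof (intro integral_mono integrable_powr integrable_mult_right integrable_square)
      fix t assume "t \<in> space ?M"
      then have t: "t \<in> {0..\<epsilon>}" by simp
      have "\<bar>w e t\<bar> powr q = \<bar>w e t\<bar> powr (q - 2) * (w e t)\<^sup>2"
        using powr_add[of "\<bar>w e t\<bar>" "q - 2" 2] by (cases "w e t = 0") auto
      also have "\<dots> \<le> L powr (q - 2) * (w e t)\<^sup>2"
        using q sup[OF t] by (intro mult_right_mono powr_mono2) auto
      finally show "\<bar>w e t\<bar> powr q \<le> L powr (q - 2) * (w e t)\<^sup>2" .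
    qed (use q in auto)
    then show ?thesis by (simp add: edge_energy_def)
  qed
  have fin2: "sum ?I F \<le> L powr (q - 2) * U" if F: "finite F" for F
  proof -
    have "sum ?I F \<le> L powr (q - 2) * (\<Sum>e\<in>F. edge_energy \<epsilon> w e)"
      unfolding sum_distrib_left by (intro sum_mono I2)
    also have "\<dots> \<le> L powr (q - 2) * U"
      by (intro mult_left_mono sum_U_le F) auto
    finally show ?thesis .
  qed
  have "(\<Sum>\<^sub>\<infinity>e. ?I e) \<le> L powr (q - 2) * U"
    by (intro infsum_le_finite_sums[OF summ] fin2)
  also have "L powr (q - 2) = (C powr (1 / q) + 1) powr (q - 2) * M powr (q / 2 - 1)"
    using nonneg by (simp add: L_def powr_mult sqrt_powr diff_divide_distrib)
  finally show "(\<Sum>\<^sub>\<infinity>e. ?I e)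
      \<le> (C powr (1 / q) + 1) powr (q - 2) * M powr (q / 2 - 1) * U" .
qed

end

section \<open>Interpolation between the endpoint bounds\<close>

lemma interpolate_le:
  fixes A B\<^sub>0 B\<^sub>1 s :: real
  assumes "0 \<le> A" "A \<le> B\<^sub>0" "A \<le> B\<^sub>1" "0 \<le> s" "s \<le> 1"
  shows "A \<le> B\<^sub>0 powr (1 - s) * B\<^sub>1 powr s"
proof -
  have "A = A powr (1 - s) * A powr s"
    using assms by (cases "A = 0") (auto simp: powr_add[symmetric])
  also have "\<dots> \<le> B\<^sub>0 powr (1 - s) * B\<^sub>1 powr s"
    using assms by (intro mult_mono powr_mono2) auto
  finally show ?thesis .
qed

theorem proposition3p2:
  fixes q \<alpha> :: real
  assumes "CARD('n::finite) \<ge> 3"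
    and "q > critical_exponent CARD('n)"
    and "0 < \<alpha>" and "\<alpha> \<le> 2"
  shows "\<exists>C>0. \<forall>\<epsilon>>0. \<forall>u \<in> (H1_grid \<epsilon> :: (real ^ 'n \<Rightarrow> real) set).
    on_edges \<epsilon> u \<in> Lp_grid \<epsilon> q \<and>
    Lp_grid_norm \<epsilon> q (on_edges \<epsilon> u) powr q \<le>
      C * \<epsilon> powr (q / 2 + 1 - \<alpha>) * Lp_grid_norm \<epsilon> 2 (on_edges \<epsilon> u) powr \<alpha>
        * Lp_grid_norm \<epsilon> 2 (grid_deriv \<epsilon> u) powr (q - \<alpha>)"
proof -
  have q: "q > 2"
    using critical_exponent_gtD(1)[OF assms(1,2)] .
  obtain C where C: "C > 0" and sob:
    "\<And>(f :: int ^ 'n \<Rightarrow> real) b. (\<lambda>x. \<bar>f x\<bar> powr q) summable_on UNIV \<Longrightarrow>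
      (\<And>i. shift_bound f (axis i 1) b) \<Longrightarrow> (\<Sum>\<^sub>\<infinity>x. \<bar>f x\<bar> powr q) \<le> C * b powr q"
    using discrete_Sobolev[OF assms(1,2)] by blast
  define K\<^sub>0 where "K\<^sub>0 = 2 powr q * (real CARD('n) * C + 1)"
  define K\<^sub>1 where "K\<^sub>1 = (C powr (1 / q) + 1) powr (q - 2)"
  \<comment> \<open>The weight that turns U^s into |u|_2^\<alpha>, since \<open>U\<close> is the
    squared norm. It and both endpoint constants are fixed before \<epsilon> and
    \<open>u\<close>.\<close>
  define s where "s = \<alpha> / 2"
  have K: "K\<^sub>0 > 0" "K\<^sub>1 > 0"
    using C add_nonneg_pos[of "C powr (1 / q)" 1]
    by (auto simp: K\<^sub>0_def K\<^sub>1_def intro!: mult_pos_pos add_nonneg_pos)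
  have s: "0 \<le> s" "s \<le> 1"
    using assms by (auto simp: s_def)
  show ?thesis
  proof (intro exI conjI allI impI ballI)
    show "K\<^sub>0 powr (1 - s) * K\<^sub>1 powr s > 0" using K by simp
    fix \<epsilon> :: real and u :: "real ^ 'n \<Rightarrow> real"
    assume eps: "\<epsilon> > 0" and u: "u \<in> H1_grid \<epsilon>"
    interpret grid_function \<epsilon> u
      by unfold_locales (use eps u in auto)
    note bounds = Lq_bounds[OF q C sob[OF summable_vertex_value shift_bound_vertex_value]]
    show "on_edges \<epsilon> u \<in> Lp_grid \<epsilon> q"
      using bounds(1) q by simp
    define S where "S = (\<Sum>\<^sub>\<infinity>e. LINT t|lebesgue_on {0..\<epsilon>}. \<bar>w e t\<bar> powr q)"
    define G where "G = (\<Sum>\<^sub>\<infinity>e. E e)"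
    have G: "G \<ge> 0" "M = \<epsilon> * G"
      by (auto simp: G_def M_def edge_energy_nonneg intro!: infsum_nonneg)
    have S0: "S \<ge> 0"
      unfolding S_def by (intro infsum_nonneg integral_nonneg_AE) auto
    have "S \<le> K\<^sub>0 * \<epsilon> * M powr (q / 2)" "S \<le> K\<^sub>1 * M powr (q / 2 - 1) * U"
      using bounds(2,3) q by (simp_all add: S_def K\<^sub>0_def K\<^sub>1_def)
    from interpolate_le[OF S0 this s]
    have "S \<le> (K\<^sub>0 * \<epsilon> * M powr (q / 2)) powr (1 - s) * (K\<^sub>1 * M powr (q / 2 - 1) * U) powr s" .
    also have "\<dots> = K\<^sub>0 powr (1 - s) * K\<^sub>1 powr s * (\<epsilon> powr (1 - s) * \<epsilon> powr (q / 2 - s))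
        * U powr s * G powr (q / 2 - s)"
    proof -
      \<comment> \<open>The exponents of \<open>M\<close> collapse to q/2 - s. Together with
        \<epsilon>^(1-s) from the first endpoint, \<epsilon> gets the exponent 1 - s + q/2 - s = q/2
        + 1 - \<alpha>.\<close>
      have "M powr (q / 2 * (1 - s)) * M powr ((q / 2 - 1) * s) = M powr (q / 2 - s)"
      proof -
        have "q / 2 * (1 - s) + (q / 2 - 1) * s = q / 2 - s"
          by (simp add: field_simps)
        then show ?thesis
          by (metis powr_add)
      qed
      moreover have "M powr (q / 2 - s) = \<epsilon> powr (q / 2 - s) * G powr (q / 2 - s)"
        using G eps by (simp add: powr_mult)
      ultimately show ?thesis
        using K eps nonneg by (simp add: powr_mult powr_powr mult_ac)
    qed
    also have "\<epsilon> powr (1 - s) * \<epsilon> powr (q / 2 - s) = \<epsilon> powr (q / 2 + 1 - \<alpha>)"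
      by (simp add: powr_add[symmetric] s_def algebra_simps)
    also have "U powr s = Lp_grid_norm \<epsilon> 2 w powr \<alpha>"
      using nonneg(2) by (simp add: Lp_grid_norm_2 U_def[symmetric] sqrt_powr s_def)
    also have "G powr (q / 2 - s) = Lp_grid_norm \<epsilon> 2 (grid_deriv \<epsilon> u) powr (q - \<alpha>)"
      using G by (simp add: Lp_grid_norm_2 G_def[symmetric] sqrt_powr s_def diff_divide_distrib)
    also have "S = Lp_grid_norm \<epsilon> q w powr q"
      using S0 q by (simp add: Lp_grid_norm_def S_def[symmetric] powr_powr)
    finally show "Lp_grid_norm \<epsilon> q (on_edges \<epsilon> u) powr q \<le>
      K\<^sub>0 powr (1 - s) * K\<^sub>1 powr s * \<epsilon> powr (q / 2 + 1 - \<alpha>) * Lp_grid_norm \<epsilon> 2 w powr \<alpha>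
        * Lp_grid_norm \<epsilon> 2 (grid_deriv \<epsilon> u) powr (q - \<alpha>)" .
  qed
qed

end
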